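(* Let $X$ be a Banach space, $k\in\mathbb{N}$ and $(x_s)_{s\in[\mathbb{N}]^k}$ a $k$-sequence in $X$ subordinated with respect to the weak topology, with weak limit $x_0$; put $x'_s=x_s-x_0$. Assume that for some infinite $M\subseteq\mathbb{N}$, $(x_s)_{s\in[M]^k}$ generates a non-trivial $k$-spreading model $(e_n)_n$. If $x_0\neq0$ then exactly one of the following holds: (i) $(e_n)_n$, as well as every $k$-spreading model of $(x'_s)_{s\in[M]^k}$, is equivalent to the usual basis of $\ell^1$; (ii) $(e_n)_n$ is singular, and if $e_n=e'_n+e$ is its natural decomposition then every $k$-spreading model of $(x'_s)_{s\in[M]^k}$ is isometrically equivalent to $(e'_n)_n$, and $\|e\|=\|x_0\|$.
   Context: $k$-sequences, subordinated $k$-sequences and $k$-spreading models: $[M]^k$ is the set of $k$-subsets of $M$ (increasing enumerations). Subordinated: there is continuous $\widehat\varphi:[\mathbb{N}]^{\le k}\to(X,w)$ (topology of $\{0,1\}^{\mathbb{N}}$ on sets of size $\le k$) with $\widehat\varphi(s)=x_s$ on $[\mathbb{N}]^k$; its weak limit is $\widehat\varphi(\emptyset)$. Plegma family: $(s_j)_{j=1}^l$ in $[M]^k$ with $s_1(i)<\dots<s_l(i)$ ($i\le k$) and $s_l(i)<s_1(i+1)$ ($i<k$). $(x_s)_{s\in[M]^k}$ generates $(e_n)$ (Hamel basis of a seminormed space $(E,\|\cdot\|_* )$) as a $k$-spreading model if for a null sequence $\delta_l>0$: $|\|\sum_{j=1}^m a_jx_{s_j}\|-\|\sum_{j=1}^m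 a_je_j\|_*|\le\delta_l$ whenever $m\le l$, $(s_j)_{j=1}^m$ plegma in $[M]^k$ with $s_1(1)\ge M(l)$, $a_j\in[-1,1]$. Spreading sequences: $(e_n)$ is trivial if $\|e_1-e_2\|_*=0$; a non-trivial spreading sequence is singular if it is not a Schauder basic sequence in the Banach space $E$ it generates. A singular spreading sequence converges weakly to some nonzero $e\in E$, and $e_n=e'_n+e$ with $e'_n=e_n-e$ is called its natural decomposition ($(e'_n)$ is then spreading, unconditional and weakly null). *)

theory Defs
  imports "HOL-Analysis.Analysis" "HOL-Library.Infinite_Set"
begin

definition kset :: "nat \<Rightarrow> nat set \<Rightarrow> bool" where
  "kset k s \<longleftrightarrow> finite s \<and> card s = k"

(* s(i) for s in [N]^k, 0-indexed: elem s 0 = s(1), ..., elem s (k-1) = s(k) *)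
definition elem :: "nat set \<Rightarrow> nat \<Rightarrow> nat" where
  "elem s i = sorted_list_of_set s ! i"

(* M(l) for infinite M, 0-indexed: Mel M 0 = M(1) = min M *)
definition Mel :: "nat set \<Rightarrow> nat \<Rightarrow> nat" where
  "Mel M l = Infinite_Set.enumerate M l"

definition weakly_converges :: "(nat \<Rightarrow> 'a::real_normed_vector) \<Rightarrow> 'a \<Rightarrow> bool" where
  "weakly_converges u y \<longleftrightarrow>
     (\<forall>f::'a \<Rightarrow> real. bounded_linear f \<longrightarrow> (\<lambda>n. f (u n)) \<longlonglongrightarrow> f y)"

(* continuity of phi : [N]^{<=k} -> (X,w), where [N]^{<=k} carries the topology
   of {0,1}^N (pointwise convergence of indicator functions).  The domain is
   metrizable, so continuity is sequential continuity. *)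
definition weakly_continuous_on_le :: "nat \<Rightarrow> (nat set \<Rightarrow> 'a::real_normed_vector) \<Rightarrow> bool" where
  "weakly_continuous_on_le k \<phi> \<longleftrightarrow>
     (\<forall>F G. (\<forall>n. finite (F n) \<and> card (F n) \<le> k) \<longrightarrow> finite G \<longrightarrow> card G \<le> k \<longrightarrow>
        (\<forall>i. eventually (\<lambda>n. i \<in> F n \<longleftrightarrow> i \<in> G) sequentially) \<longrightarrow>
        weakly_converges (\<lambda>n. \<phi> (F n)) (\<phi> G))"

definition subordinated_weak :: "nat \<Rightarrow> (nat set \<Rightarrow> 'a::real_normed_vector) \<Rightarrow> 'a \<Rightarrow> bool" where
  "subordinated_weak k x x0 \<longleftrightarrow>
     (\<exists>\<phi>. (\<forall>s. kset k s \<longrightarrow> \<phi> s = x s) \<and> weakly_continuous_on_le k \<phi> \<and> \<phi> {} = x0)"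

(* (ss j)_{j<m} is a plegma family in [M]^k (0-indexed: ss 0 = s_1, ..., ss (m-1) = s_m) *)
definition plegma :: "nat set \<Rightarrow> nat \<Rightarrow> (nat \<Rightarrow> nat set) \<Rightarrow> nat \<Rightarrow> bool" where
  "plegma M k ss m \<longleftrightarrow>
     (\<forall>j<m. kset k (ss j) \<and> ss j \<subseteq> M) \<and>
     (\<forall>i<k. \<forall>j. Suc j < m \<longrightarrow> elem (ss j) i < elem (ss (Suc j)) i) \<and>
     (\<forall>i. Suc i < k \<longrightarrow> elem (ss (m - 1)) i < elem (ss 0) (Suc i))"

(* realisation of the spreading model (e_n) as a sequence in a normed space
   (e 0 = e_1, e 1 = e_2, ...), forming a Hamel basis of its linear span *)
definition generates_ksm ::
  "nat \<Rightarrow> (nat set \<Rightarrow> 'a::real_normed_vector) \<Rightarrow> nat set \<Rightarrow> (nat \<Rightarrow> 'b::real_normed_vector) \<Rightarrow> bool" where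
  "generates_ksm k x M e \<longleftrightarrow>
     inj e \<and> independent (range e) \<and>
     (\<exists>\<delta>::nat \<Rightarrow> real. (\<forall>l. 0 < \<delta> l) \<and> \<delta> \<longlonglongrightarrow> 0 \<and>
        (\<forall>l m ss a. 1 \<le> l \<longrightarrow> m \<le> l \<longrightarrow> plegma M k ss m \<longrightarrow> 0 < m \<longrightarrow>
           Mel M (l - 1) \<le> elem (ss 0) 0 \<longrightarrow> (\<forall>j<m. \<bar>a j\<bar> \<le> 1) \<longrightarrow>
           \<bar>norm (\<Sum>j<m. a j *\<^sub>R x (ss j)) - norm (\<Sum>j<m. a j *\<^sub>R e j)\<bar> \<le> \<delta> l))"

(* A seminormed space with Hamel basis (e_n) is represented by the free vector
   space of finitely supported coefficient functions nat => real together with a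
   seminorm p: p a = || sum_j a j e_j ||_* . *)
definition finsupp :: "(nat \<Rightarrow> real) \<Rightarrow> bool" where
  "finsupp a \<longleftrightarrow> finite {j. a j \<noteq> 0}"

definition is_seminorm :: "((nat \<Rightarrow> real) \<Rightarrow> real) \<Rightarrow> bool" where
  "is_seminorm p \<longleftrightarrow>
     (\<forall>a b. finsupp a \<longrightarrow> finsupp b \<longrightarrow> p (\<lambda>j. a j + b j) \<le> p a + p b) \<and>
     (\<forall>a c. finsupp a \<longrightarrow> p (\<lambda>j. c * a j) = \<bar>c\<bar> * p a)"

definition trunc :: "nat \<Rightarrow> (nat \<Rightarrow> real) \<Rightarrow> nat \<Rightarrow> real" where
  "trunc m a = (\<lambda>j. if j < m then a j else 0)"

definition generates_ksm_sn ::
  "nat \<Rightarrow> (nat set \<Rightarrow> 'a::real_normed_vector) \<Rightarrow> nat set \<Rightarrow> ((nat \<Rightarrow> real) \<Rightarrow> real) \<Rightarrow> bool" where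
  "generates_ksm_sn k x M p \<longleftrightarrow>
     is_seminorm p \<and>
     (\<exists>\<delta>::nat \<Rightarrow> real. (\<forall>l. 0 < \<delta> l) \<and> \<delta> \<longlonglongrightarrow> 0 \<and>
        (\<forall>l m ss a. 1 \<le> l \<longrightarrow> m \<le> l \<longrightarrow> plegma M k ss m \<longrightarrow> 0 < m \<longrightarrow>
           Mel M (l - 1) \<le> elem (ss 0) 0 \<longrightarrow> (\<forall>j<m. \<bar>a j\<bar> \<le> 1) \<longrightarrow>
           \<bar>norm (\<Sum>j<m. a j *\<^sub>R x (ss j)) - p (trunc m a)\<bar> \<le> \<delta> l))"

definition is_ksm_of :: "nat \<Rightarrow> (nat set \<Rightarrow> 'a::real_normed_vector) \<Rightarrow> nat set \<Rightarrow> ((nat \<Rightarrow> real) \<Rightarrow> real) \<Rightarrow> bool" where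
  "is_ksm_of k x M p \<longleftrightarrow> (\<exists>L. infinite L \<and> L \<subseteq> M \<and> generates_ksm_sn k x L p)"

definition nontrivial_seq :: "(nat \<Rightarrow> 'b::real_normed_vector) \<Rightarrow> bool" where
  "nontrivial_seq e \<longleftrightarrow> norm (e 0 - e 1) \<noteq> 0"

definition schauder_basic :: "(nat \<Rightarrow> 'b::real_normed_vector) \<Rightarrow> bool" where
  "schauder_basic e \<longleftrightarrow>
     (\<forall>y \<in> closure (span (range e)). \<exists>!a::nat \<Rightarrow> real. (\<lambda>n. a n *\<^sub>R e n) sums y)"

definition singular_seq :: "(nat \<Rightarrow> 'b::real_normed_vector) \<Rightarrow> bool" where
  "singular_seq e \<longleftrightarrow> nontrivial_seq e \<and> \<not> schauder_basic e"

(* e_n = e'_n + e0 with e0 the weak limit of (e_n) *)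
definition natural_decomposition :: "(nat \<Rightarrow> 'b::real_normed_vector) \<Rightarrow> 'b \<Rightarrow> bool" where
  "natural_decomposition e e0 \<longleftrightarrow>
     singular_seq e \<and> e0 \<in> closure (span (range e)) \<and> weakly_converges e e0"

definition l1_equiv :: "(nat \<Rightarrow> 'b::real_normed_vector) \<Rightarrow> bool" where
  "l1_equiv e \<longleftrightarrow> (\<exists>c C. 0 < c \<and> (\<forall>m a.
      c * (\<Sum>j<m. \<bar>a j\<bar>) \<le> norm (\<Sum>j<m. a j *\<^sub>R e j) \<and>
      norm (\<Sum>j<m. a j *\<^sub>R e j) \<le> C * (\<Sum>j<m. \<bar>a j\<bar>)))"

definition l1_equiv_sn :: "((nat \<Rightarrow> real) \<Rightarrow> real) \<Rightarrow> bool" where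
  "l1_equiv_sn p \<longleftrightarrow> (\<exists>c C. 0 < c \<and> (\<forall>m a.
      c * (\<Sum>j<m. \<bar>a j\<bar>) \<le> p (trunc m a) \<and> p (trunc m a) \<le> C * (\<Sum>j<m. \<bar>a j\<bar>)))"

definition isometric_equiv_sn :: "((nat \<Rightarrow> real) \<Rightarrow> real) \<Rightarrow> (nat \<Rightarrow> 'b::real_normed_vector) \<Rightarrow> bool" where
  "isometric_equiv_sn p u \<longleftrightarrow> (\<forall>m a. p (trunc m a) = norm (\<Sum>j<m. a j *\<^sub>R u j))"

end

theory Submission
  imports Defs
begin

text \<open>Inside a plegma family far out in \<open>M\<close>, any chosen set of terms can be replaced, by Mazur's theorem
  applied successively to the \<open>k\<close> coordinates, by convex combinations close to the weak limit \<open>x0\<close>,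
  all choices occurring in the combinations still being plegma. Hence replacing some of the \<open>x (s j)\<close>
  in \<open>\<Sum> c\<^sub>j x (s j)\<close> by \<open>x0\<close> yields, for suitable far families, a vector of norm at most
  \<open>\<parallel>\<Sum> c\<^sub>j e\<^sub>j\<parallel>\<close> up to an arbitrarily small error; in particular
  \<open>\<bar>\<Sum> c\<^sub>j\<bar> \<parallel>x0\<parallel> \<le> \<parallel>\<Sum> c\<^sub>j e\<^sub>j\<parallel>\<close>.

  If \<open>(e\<^sub>n)\<close> is not equivalent to the basis of \<open>\<ell>\<^sup>1\<close>, some \<open>\<Sum> a\<^sub>j e\<^sub>j\<close> with \<open>\<Sum> \<bar>a\<^sub>j\<bar> = 1\<close> has small
  norm, so \<open>\<Sum> a\<^sub>j\<close> is almost \<open>0\<close> and the positive part of \<open>a\<close> carries about half of the mass. Normalising it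
  gives a convex combination \<open>b\<close> for which \<open>\<Sum> b\<^sub>j (x (s j) - x0)\<close> is small. These convex combinations of
  \<open>(e\<^sub>n)\<close> converge in norm to a shift-invariant vector \<open>e\<close> with \<open>\<parallel>e\<parallel> = \<parallel>x0\<parallel>\<close>, which rules out a Schauder
  expansion of \<open>e\<close>, and subtracting multiples of them makes any combination of the \<open>x s - x0\<close> a
  combination of the \<open>x s\<close> with coefficient sum \<open>0\<close>, on which the two spreading models agree.
  If \<open>(e\<^sub>n)\<close> is equivalent to the basis of \<open>\<ell>\<^sup>1\<close>, coefficient sequences \<open>(a, -a)\<close> transfer the lower
  estimate to the differences \<open>x s - x0\<close>.\<close>

section \<open>Hahn--Banach separation and Mazur's theorem\<close>

definition sublinear :: "('a::real_vector \<Rightarrow> real) \<Rightarrow> bool" where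
  "sublinear p \<longleftrightarrow> (\<forall>x y. p (x + y) \<le> p x + p y) \<and> (\<forall>t x. 0 \<le> t \<longrightarrow> p (t *\<^sub>R x) = t * p x)"

lemma sublinear_add: "sublinear p \<Longrightarrow> p (x + y) \<le> p x + p y"
  and sublinear_scale: "sublinear p \<Longrightarrow> 0 \<le> t \<Longrightarrow> p (t *\<^sub>R x) = t * p x"
  by (auto simp: sublinear_def)

lemma sublinear_zero: "sublinear p \<Longrightarrow> p 0 = 0"
  using sublinear_scale[of p 0 0] by simp

lemma sublinear_neg_le: "sublinear p \<Longrightarrow> - p (- x) \<le> p x"
  using sublinear_add[of p x "- x"] sublinear_zero[of p] by simp

lemma mult_cINF:
  fixes f :: "'i \<Rightarrow> real"
  assumes "A \<noteq> {}" and "bdd_below (f ` A)" and "0 < t"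
  shows "t * (INF i\<in>A. f i) \<le> (INF i\<in>A. t * f i)"
  using assms by (intro cINF_greatest) (auto intro: cINF_lower)

text \<open>Subadditivity has to bound the infimum at \<open>x + y\<close> by
  \<open>q x + r y\<close> for two different members. The chain condition supplies a member below
  both, and subadditivity of that one suffices.\<close>

lemma sublinear_chain_Inf:
  fixes C :: "('a::real_vector \<Rightarrow> real) set"
  assumes "C \<noteq> {}" and sub: "\<And>q. q \<in> C \<Longrightarrow> sublinear q"
    and chain: "\<And>q r. q \<in> C \<Longrightarrow> r \<in> C \<Longrightarrow> q \<le> r \<or> r \<le> q"
    and bdd: "\<And>x. bdd_below ((\<lambda>q. q x) ` C)"
  shows "sublinear (\<lambda>x. INF q\<in>C. q x)"
  unfolding sublinear_def
proof (intro conjI allI impI)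
  fix x y :: 'a
  have "(INF q\<in>C. q (x + y)) \<le> q x + r y" if "q \<in> C" "r \<in> C" for q r
  proof -
    obtain s where s: "s \<in> C" "s \<le> q" "s \<le> r"
      using chain[OF \<open>q \<in> C\<close> \<open>r \<in> C\<close>] \<open>q \<in> C\<close> \<open>r \<in> C\<close> by auto
    have "(INF q\<in>C. q (x + y)) \<le> s (x + y)"
      using bdd s by (auto intro: cINF_lower)
    also have "\<dots> \<le> s x + s y" using sub s by (auto intro: sublinear_add)
    also have "\<dots> \<le> q x + r y" using s by (auto simp: le_fun_def intro: add_mono)
    finally show ?thesis .
  qed
  then have "(INF q\<in>C. q (x + y)) - r y \<le> (INF q\<in>C. q x)" if "r \<in> C" for r
    using that assms(1) by (intro cINF_greatest) (auto simp: algebra_simps)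
  then have "(INF q\<in>C. q (x + y)) - (INF q\<in>C. q x) \<le> (INF r\<in>C. r y)"
    using assms(1) by (intro cINF_greatest) (auto simp: algebra_simps)
  then show "(INF q\<in>C. q (x + y)) \<le> (INF q\<in>C. q x) + (INF q\<in>C. q y)" by simp
next
  fix t :: real and x :: 'a
  assume t: "0 \<le> t"
  have eq: "(INF q\<in>C. q (t *\<^sub>R x)) = (INF q\<in>C. t * q x)"
    using sub t by (intro INF_cong) (auto simp: sublinear_scale)
  show "(INF q\<in>C. q (t *\<^sub>R x)) = t * (INF q\<in>C. q x)"
  proof (cases "t = 0")
    case True
    then show ?thesis using eq assms(1) by simp
  next
    case False
    with t have t: "0 < t" by simp
    have "bdd_below ((\<lambda>q. t * q x) ` C)"
    proof -
      from bdd[of x] obtain b where "\<And>q. q \<in> C \<Longrightarrow> b \<le> q x" by (auto simp: bdd_below_def)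
      then show ?thesis using t by (intro bdd_belowI2[where m = "t * b"]) auto
    qed
    then have "inverse t * (INF q\<in>C. t * q x) \<le> (INF q\<in>C. q x)"
      using mult_cINF[of C "\<lambda>q. t * q x" "inverse t"] assms(1) t by (simp add: mult.assoc[symmetric])
    then have "(INF q\<in>C. t * q x) \<le> t * (INF q\<in>C. q x)"
      using t by (simp add: field_simps)
    then show ?thesis
      using mult_cINF[of C "\<lambda>q. q x" t] assms(1) bdd t eq by force
  qed
qed

text \<open>The tilt lies below \<open>q\<close> by \<open>t = 0\<close>, and \<open>t = 1\<close>
  gives \<open>r y x \<le> q (x + y) - q y\<close>. So if no sublinear functional lies strictly
  below \<open>q\<close>, then \<open>q\<close> is superadditive as well.\<close>

lemma sublinear_tilt:
  fixes q :: "'a::real_vector \<Rightarrow> real"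
  assumes q: "sublinear q"
  defines "r \<equiv> \<lambda>y x. INF t\<in>{0..}. q (x + t *\<^sub>R y) - t * q y"
  shows sublinear_tilt_sublinear: "sublinear (r y)"
    and sublinear_tilt_le: "0 \<le> t \<Longrightarrow> r y x \<le> q (x + t *\<^sub>R y) - t * q y"
proof -
  have r_eq: "r y x = (INF t\<in>{0..}. q (x + t *\<^sub>R y) - t * q y)" for x y
    by (simp add: r_def)
  \<comment> \<open>The lower bound does not depend on \<open>t\<close>, so the infimum is a genuine
    real number.\<close>
  have low: "- q (- x) \<le> q (x + t *\<^sub>R y) - t * q y" if "0 \<le> t" for t x
    using sublinear_add[OF q, of "- x" "x + t *\<^sub>R y"] sublinear_scale[OF q that, of y] by simp
  have bdd: "bdd_below ((\<lambda>t. q (x + t *\<^sub>R y) - t * q y) ` {0..})" for x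
    using low by (intro bdd_belowI2[where m = "- q (- x)"]) auto
  show le: "r y x \<le> q (x + t *\<^sub>R y) - t * q y" if "0 \<le> t" for t x
    unfolding r_def using bdd that by (auto intro: cINF_lower)
  show "sublinear (r y)"
    unfolding sublinear_def
  proof (intro conjI allI impI)
    fix x z
    have *: "r y (x + z) \<le> (q (x + t *\<^sub>R y) - t * q y) + (q (z + s *\<^sub>R y) - s * q y)"
      if "0 \<le> t" "0 \<le> s" for t s
      using le[of "t + s" "x + z"] that
        sublinear_add[OF q, of "x + t *\<^sub>R y" "z + s *\<^sub>R y"]
      by (simp add: algebra_simps)
    have "r y (x + z) - (q (z + s *\<^sub>R y) - s * q y) \<le> r y x" if "0 \<le> s" for s
      unfolding r_eq[of y x] using *[OF _ that]
      by (intro cINF_greatest) (auto simp: algebra_simps)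
    then have "r y (x + z) - r y x \<le> r y z"
      unfolding r_eq[of y z] by (intro cINF_greatest) (auto simp: algebra_simps)
    then show "r y (x + z) \<le> r y x + r y z" by simp
  next
    fix c :: real and x
    have half: "r y (c *\<^sub>R x) \<le> c * r y x" if c: "0 < c" for c x
    proof -
      have "inverse c * r y (c *\<^sub>R x) \<le> r y x"
        unfolding r_eq[of y x]
      proof (intro cINF_greatest)
        fix t :: real assume "t \<in> {0..}"
        then have t: "0 \<le> t" by simp
        have "r y (c *\<^sub>R x) \<le> q (c *\<^sub>R x + (c * t) *\<^sub>R y) - (c * t) * q y"
          using le[of "c * t" "c *\<^sub>R x"] c t by simp
        also have "c *\<^sub>R x + (c * t) *\<^sub>R y = c *\<^sub>R (x + t *\<^sub>R y)" by (simp add: scaleR_add_right)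
        also have "q \<dots> = c * q (x + t *\<^sub>R y)" using c by (simp add: sublinear_scale[OF q])
        finally show "inverse c * r y (c *\<^sub>R x) \<le> q (x + t *\<^sub>R y) - t * q y"
          using c by (simp add: field_simps)
      qed simp
      then show ?thesis using c by (simp add: field_simps)
    qed
    assume "0 \<le> c"
    show "r y (c *\<^sub>R x) = c * r y x"
    proof (cases "c = 0")
      case True
      have "r y 0 = 0"
      proof (rule antisym)
        show "r y 0 \<le> 0" using le[of 0 0] by (simp add: sublinear_zero[OF q])
        show "0 \<le> r y 0" unfolding r_eq
          using sublinear_scale[OF q] by (intro cINF_greatest) auto
      qed
      then show ?thesis using True by simp
    next
      case False
      with \<open>0 \<le> c\<close> have c: "0 < c" by simp
      have "r y x \<le> inverse c * r y (c *\<^sub>R x)"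
        using half[of "inverse c" "c *\<^sub>R x"] c by simp
      then show ?thesis using half[OF c, of x] c by (simp add: field_simps)
    qed
  qed
qed

text \<open>Hahn--Banach via Zorn applied to sublinear functionals themselves: a minimal one is additive,
  since tilting it in any direction \<open>y\<close> cannot make it smaller.\<close>

theorem sublinear_dominates_linear:
  fixes p :: "'a::real_vector \<Rightarrow> real"
  assumes p: "sublinear p"
  obtains f where "linear f" and "\<And>x. f x \<le> p x"
proof -
  define A where "A = {q. sublinear q \<and> q \<le> p}"
  have "\<exists>m\<in>A. \<forall>a\<in>A. m \<ge> a \<longrightarrow> a = m"
  proof (rule predicate_Zorn)
    \<comment> \<open>The order is reversed: the maximal elements delivered by Zorn are the minimal
      sublinear functionals below \<open>p\<close>.\<close>
    show "partial_order_on A (relation_of (\<lambda>x y. y \<le> x) A)"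
      by (rule partial_order_on_relation_ofI) auto
    fix C assume C: "C \<in> Chains (relation_of (\<lambda>x y. y \<le> x) A)"
    then have CA: "C \<subseteq> A" and chain: "\<And>q r. q \<in> C \<Longrightarrow> r \<in> C \<Longrightarrow> q \<le> r \<or> r \<le> q"
      by (auto simp: Chains_def relation_of_def)
    show "\<exists>u\<in>A. \<forall>a\<in>C. u \<le> a"
    proof (cases "C = {}")
      case True
      then show ?thesis using p by (auto simp: A_def)
    next
      case False
      have bdd: "bdd_below ((\<lambda>q. q x) ` C)" for x
      proof (intro bdd_belowI2[where m = "- p (- x)"])
        fix q assume "q \<in> C"
        then have "sublinear q" "q (- x) \<le> p (- x)" using CA by (auto simp: A_def le_fun_def)
        then show "- p (- x) \<le> q x" using sublinear_neg_le[of q x] by linarith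
      qed
      define u where "u = (\<lambda>x. INF q\<in>C. q x)"
      have "sublinear u"
        unfolding u_def using False CA chain bdd
        by (intro sublinear_chain_Inf) (auto simp: A_def)
      moreover have le: "u \<le> q" if "q \<in> C" for q
        unfolding u_def le_fun_def using bdd that by (auto intro: cINF_lower)
      moreover have "u \<le> p"
        using False CA le by (force simp: A_def intro: order_trans)
      ultimately show ?thesis by (auto simp: A_def)
    qed
  qed
  then obtain q where q: "sublinear q" "q \<le> p" and min: "\<And>r. sublinear r \<Longrightarrow> r \<le> q \<Longrightarrow> r = q"
    unfolding A_def by (auto intro: order_trans)
  have super: "q x + q y \<le> q (x + y)" for x y
  proof -
    define r where "r = (\<lambda>x. INF t\<in>{0..}. q (x + t *\<^sub>R y) - t * q y)"
    have "sublinear r" unfolding r_def by (rule sublinear_tilt_sublinear[OF q(1)])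
    moreover have le: "r x \<le> q (x + t *\<^sub>R y) - t * q y" if "0 \<le> t" for t x
      unfolding r_def by (rule sublinear_tilt_le[OF q(1) that])
    have "r \<le> q" using le[of 0] by (auto simp: le_fun_def)
    ultimately have "r = q" by (rule min)
    then show ?thesis using le[of 1 x] by simp
  qed
  have add: "q (x + y) = q x + q y" for x y
    using super[of x y] sublinear_add[OF q(1), of x y] by simp
  have neg: "q (- x) = - q x" for x
    using add[of x "- x"] sublinear_zero[OF q(1)] by simp
  have "linear q"
  proof (rule linearI)
    fix c x
    show "q (c *\<^sub>R x) = c *\<^sub>R q x"
    proof (cases "0 \<le> c")
      case False
      then have "q (- (c *\<^sub>R x)) = - c * q x"
        using sublinear_scale[OF q(1), of "- c" x] by simp
      then show ?thesis using neg[of "c *\<^sub>R x"] by simp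
    qed (simp add: sublinear_scale[OF q(1)])
  qed (rule add)
  with q(2) show ?thesis by (intro that[of q]) (auto simp: le_fun_def)
qed

text \<open>Hahn--Banach is applied to the infimum \<open>p\<close> of
  \<open>norm (x + t *\<^sub>R c) - t * d\<close>. The choice \<open>t = 0\<close> gives
  \<open>p \<le> norm\<close>, hence boundedness of \<open>f\<close>; the choice
  \<open>x = - c\<close>, \<open>t = 1\<close> gives \<open>f (- c) \<le> - d\<close>. The distance
  assumption keeps the infimum finite.\<close>

theorem convex_separation_from_ball:
  fixes C :: "'a::real_normed_vector set"
  assumes "convex C" and "C \<noteq> {}" and far: "\<And>c. c \<in> C \<Longrightarrow> d \<le> norm c" and d: "0 \<le> d"
  obtains f :: "'a \<Rightarrow> real" where "bounded_linear f" and "\<And>c. c \<in> C \<Longrightarrow> d \<le> f c"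
proof -
  define I where "I = {(t::real, c). 0 \<le> t \<and> c \<in> C}"
  define g :: "'a \<Rightarrow> real \<times> 'a \<Rightarrow> real"
    where "g = (\<lambda>x (t, c). norm (x + t *\<^sub>R c) - t * d)"
  define p where "p = (\<lambda>x. INF i\<in>I. g x i)"
  have p_eq: "p x = (INF i\<in>I. g x i)" for x by (simp add: p_def)
  have ne: "I \<noteq> {}" using assms(2) by (auto simp: I_def)
  have low: "- norm x \<le> g x i" if "i \<in> I" for x i
  proof -
    obtain t c where i: "i = (t, c)" "0 \<le> t" "c \<in> C" using \<open>i \<in> I\<close> by (auto simp: I_def)
    have "t * d \<le> norm (t *\<^sub>R c)" using far[OF i(3)] i(2) by (simp add: mult_left_mono)
    also have "\<dots> \<le> norm (x + t *\<^sub>R c) + norm x"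
      using norm_triangle_ineq4[of "x + t *\<^sub>R c" x] by simp
    finally show ?thesis by (simp add: g_def i(1))
  qed
  then have bdd: "bdd_below (g x ` I)" for x by (intro bdd_belowI2[where m = "- norm x"]) auto
  have le: "p x \<le> norm (x + t *\<^sub>R c) - t * d" if "0 \<le> t" "c \<in> C" for x t c
    using cINF_lower[OF bdd, of "(t, c)" x] that by (auto simp: p_def g_def I_def)
  have p_norm: "p x \<le> norm x" for x
    using assms(2) le[of 0 _ x] by auto
  have "sublinear p"
    unfolding sublinear_def
  proof (intro conjI allI impI)
    fix x y
    have *: "p (x + y) \<le> g x i + g y j" if ij: "i \<in> I" "j \<in> I" for i j
    proof -
      obtain t c s b where i: "i = (t, c)" "0 \<le> t" "c \<in> C" and j: "j = (s, b)" "0 \<le> s" "b \<in> C"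
        using ij by (auto simp: I_def)
      \<comment> \<open>Convexity merges the two weighted points into a multiple of one point of
        \<open>C\<close>. If both weights vanish, any point of \<open>C\<close> serves.\<close>
      obtain z where z: "z \<in> C" "(t + s) *\<^sub>R z = t *\<^sub>R c + s *\<^sub>R b"
      proof (cases "t + s = 0")
        case True
        then have "t = 0" "s = 0" using i j by auto
        then show ?thesis using that[of c] i by simp
      next
        case False
        then have "(t / (t + s)) *\<^sub>R c + (s / (t + s)) *\<^sub>R b \<in> C"
          using i j assms(1) by (intro convexD) (auto simp: add_divide_distrib[symmetric])
        then show ?thesis using False by (intro that) (auto simp: scaleR_add_right)
      qed
      have "p (x + y) \<le> norm ((x + y) + (t + s) *\<^sub>R z) - (t + s) * d"
        using le z(1) i j by simp
      also have "(x + y) + (t + s) *\<^sub>R z = (x + t *\<^sub>R c) + (y + s *\<^sub>R b)"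
        using z(2) by (simp add: algebra_simps)
      also have "norm \<dots> - (t + s) * d \<le> g x i + g y j"
        using norm_triangle_ineq[of "x + t *\<^sub>R c" "y + s *\<^sub>R b"]
        by (simp add: g_def i(1) j(1) algebra_simps)
      finally show ?thesis .
    qed
    have "p (x + y) - g y j \<le> p x" if "j \<in> I" for j
      unfolding p_eq[of x] using *[OF _ that] ne
      by (intro cINF_greatest) (auto simp: algebra_simps)
    then have "p (x + y) - p x \<le> p y"
      unfolding p_eq[of y] using ne by (intro cINF_greatest) (auto simp: algebra_simps)
    then show "p (x + y) \<le> p x + p y" by simp
  next
    have half: "p (c *\<^sub>R x) \<le> c * p x" if c: "0 < c" for c x
    proof -
      have "inverse c * p (c *\<^sub>R x) \<le> g x i" if "i \<in> I" for i
      proof -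
        obtain t b where i: "i = (t, b)" "0 \<le> t" "b \<in> C" using \<open>i \<in> I\<close> by (auto simp: I_def)
        have "p (c *\<^sub>R x) \<le> norm (c *\<^sub>R x + (c * t) *\<^sub>R b) - (c * t) * d"
          using le i c by simp
        also have "c *\<^sub>R x + (c * t) *\<^sub>R b = c *\<^sub>R (x + t *\<^sub>R b)" by (simp add: scaleR_add_right)
        also have "norm \<dots> = c * norm (x + t *\<^sub>R b)" using c by simp
        finally show ?thesis using c by (simp add: field_simps g_def i(1))
      qed
      then have "inverse c * p (c *\<^sub>R x) \<le> p x"
        unfolding p_eq[of x] using ne by (intro cINF_greatest)
      then show ?thesis using c by (simp add: field_simps)
    qed
    fix c :: real and x
    assume "0 \<le> c"
    show "p (c *\<^sub>R x) = c * p x"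
    proof (cases "c = 0")
      case True
      have "p 0 = 0"
        using p_norm[of 0] low[of _ 0] ne by (intro antisym) (auto simp: p_def intro: cINF_greatest)
      then show ?thesis using True by simp
    next
      case False
      with \<open>0 \<le> c\<close> have c: "0 < c" by simp
      have "p x \<le> inverse c * p (c *\<^sub>R x)"
        using half[of "inverse c" "c *\<^sub>R x"] c by simp
      then show ?thesis using half[OF c, of x] c by (simp add: field_simps)
    qed
  qed
  then obtain f where f: "linear f" "\<And>x. f x \<le> p x"
    using sublinear_dominates_linear by blast
  have "norm (f x) \<le> norm x * 1" for x
    using f(2)[of x] f(2)[of "- x"] p_norm[of x] p_norm[of "- x"] linear_neg[OF f(1), of x]
    by simp
  then have "bounded_linear f"
    using f(1) by (intro bounded_linear_intro[where K = 1]) (auto simp: linear_add linear_scale)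
  moreover have "d \<le> f c" if "c \<in> C" for c
    using f(2)[of "- c"] le[of 1 c "- c"] that linear_neg[OF f(1), of c] by simp
  ultimately show ?thesis by (rule that)
qed

lemma functionals_separate_points:
  fixes x y :: "'a::real_normed_vector"
  assumes "\<And>f::'a \<Rightarrow> real. bounded_linear f \<Longrightarrow> f x = f y"
  shows "x = y"
proof -
  obtain f :: "'a \<Rightarrow> real" where f: "bounded_linear f" "norm (x - y) \<le> f (x - y)"
    using convex_separation_from_ball[of "{x - y}" "norm (x - y)"] by auto
  then show ?thesis using assms[OF f(1)] 
    by (simp add: bounded_linear.linear linear_diff)
qed

text \<open>Otherwise the hull, translated by \<open>- y\<close>, stays at distance at least
  \<epsilon> from 0, and the separating functional keeps \<open>f (u n) - f y\<close> above
  \<epsilon>, against weak convergence.\<close>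

theorem Mazur_sequence:
  fixes u :: "nat \<Rightarrow> 'a::real_normed_vector"
  assumes "weakly_converges u y" and \<epsilon>: "0 < \<epsilon>"
  shows "\<exists>z \<in> convex hull (range u). norm (y - z) < \<epsilon>"
proof (rule ccontr)
  assume neg: "\<not> ?thesis"
  define C where "C = (\<lambda>z. z - y) ` (convex hull (range u))"
  have "convex C"
    unfolding C_def using convex_translation_subtract by (auto simp: convex_convex_hull)
  moreover have "C \<noteq> {}" by (simp add: C_def)
  moreover have "\<epsilon> \<le> norm c" if "c \<in> C" for c
    using neg that by (force simp: C_def norm_minus_commute)
  ultimately obtain f :: "'a \<Rightarrow> real" where f: "bounded_linear f" "\<And>c. c \<in> C \<Longrightarrow> \<epsilon> \<le> f c"
    using convex_separation_from_ball[of C \<epsilon>] \<epsilon> by (auto simp: less_imp_le)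
  have "\<epsilon> \<le> f (u n) - f y" for n
    using f(2)[of "u n - y"] bounded_linear.linear[OF f(1)]
    by (auto simp: C_def hull_inc linear_diff)
  moreover have "(\<lambda>n. f (u n) - f y) \<longlonglongrightarrow> f y - f y"
    using assms(1) f(1) by (intro tendsto_intros) (auto simp: weakly_converges_def)
  ultimately have "\<epsilon> \<le> f y - f y" by (intro LIMSEQ_le_const) auto
  with \<epsilon> show False by simp
qed

section \<open>Averaging inside plegma families\<close>

lemma elem_in:
  assumes "kset k s" and "i < k"
  shows "elem s i \<in> s"
  using assms nth_mem[of i "sorted_list_of_set s"] by (simp add: elem_def kset_def)

lemma elem_cases:
  assumes "kset k s" and "a \<in> s"
  obtains i where "i < k" and "a = elem s i"
  using assms that
  by (metis elem_def in_set_conv_nth kset_def length_sorted_list_of_set set_sorted_list_of_set)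

lemma elem_insert_greater:
  assumes "kset k s" and "\<And>a. a \<in> s \<Longrightarrow> a < n"
  shows "i < k \<Longrightarrow> elem (insert n s) i = elem s i" and "elem (insert n s) k = n"
proof -
  have "n \<notin> s" using assms(2) by blast
  then have "sorted_list_of_set (insert n s) = sorted_list_of_set s @ [n]"
    using assms
    by (subst sorted_list_of_set_unique[symmetric]) (auto simp: sorted_wrt_append kset_def)
  then show "i < k \<Longrightarrow> elem (insert n s) i = elem s i" and "elem (insert n s) k = n"
    using assms(1) by (simp_all add: elem_def kset_def nth_append)
qed

lemma plegma_mono: "plegma L k ss m \<Longrightarrow> L \<subseteq> M \<Longrightarrow> plegma M k ss m"
  by (auto simp: plegma_def)

lemma plegma_elem_mono:
  assumes "plegma M k ss n" and "i < k" and "j \<le> j'" and "j' < n"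
  shows "elem (ss j) i \<le> elem (ss j') i"
  using assms(3,4)
proof (induction j' rule: dec_induct)
  case (step j')
  then have "elem (ss j') i < elem (ss (Suc j')) i"
    using assms(1,2) by (auto simp: plegma_def)
  with step show ?case by simp
qed simp

text \<open>Any run of consecutive members is again plegma, and its first element does not move to
  the left. Thus one far family can be tested against several limits at once.\<close>

lemma plegma_interval:
  assumes p: "plegma M k ss n" and rm: "r + m \<le> n" "0 < m" and k: "1 \<le> k"
  shows "plegma M k (\<lambda>j. ss (r + j)) m" and "elem (ss 0) 0 \<le> elem (ss r) 0"
proof -
  show "elem (ss 0) 0 \<le> elem (ss r) 0"
    using plegma_elem_mono[OF p, of 0 0 r] rm k by simp
  have "elem (ss (r + (m - 1))) i < elem (ss r) (Suc i)" if "Suc i < k" for i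
  proof -
    have "elem (ss (r + (m - 1))) i \<le> elem (ss (n - 1)) i"
      using that rm by (intro plegma_elem_mono[OF p]) auto
    also have "\<dots> < elem (ss 0) (Suc i)" using p that by (auto simp: plegma_def)
    also have "\<dots> \<le> elem (ss r) (Suc i)" using that rm by (intro plegma_elem_mono[OF p]) auto
    finally show ?thesis .
  qed
  then show "plegma M k (\<lambda>j. ss (r + j)) m"
    using p rm unfolding plegma_def by auto
qed

text \<open>The thresholds \<open>T\<close> cut \<open>L\<close> into consecutive slots; slot \<open>i * m + j\<close> is reserved for the
  \<open>i\<close>-th element of the \<open>j\<close>-th set, so that arbitrary choices form plegma families.\<close>

definition slotted :: "nat set \<Rightarrow> (nat \<Rightarrow> nat) \<Rightarrow> nat \<Rightarrow> nat \<Rightarrow> nat \<Rightarrow> nat set set" where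
  "slotted L T m j k = {u. kset k u \<and> u \<subseteq> L \<and>
     (\<forall>i<k. T (i * m + j) < elem u i \<and> elem u i \<le> T (Suc (i * m + j)))}"

text \<open>Within row \<open>i\<close> the slots increase with \<open>j\<close>; the last slot of
  row \<open>i\<close> ends at \<open>T (Suc i * m)\<close>, exactly where row \<open>Suc i\<close>
  begins.\<close>

lemma slotted_plegma:
  assumes T: "mono T" and m: "0 < m" and k: "1 \<le> k"
    and ss: "\<And>j. j < m \<Longrightarrow> ss j \<in> slotted L T m j k"
  shows "plegma L k ss m" and "T 0 < elem (ss 0) 0"
proof -
  show "T 0 < elem (ss 0) 0" using ss[OF m] k by (auto simp: slotted_def)
  have "elem (ss j) i < elem (ss (Suc j)) i" if "i < k" "Suc j < m" for i j
    using ss[of j] ss[of "Suc j"] that by (force simp: slotted_def)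
  moreover have "elem (ss (m - 1)) i < elem (ss 0) (Suc i)" if "Suc i < k" for i
  proof -
    have "elem (ss (m - 1)) i \<le> T (Suc (i * m + (m - 1)))"
      using ss[of "m - 1"] that m by (auto simp: slotted_def)
    also have "Suc (i * m + (m - 1)) = Suc i * m + 0" using m by simp
    also have "T (Suc i * m + 0) < elem (ss 0) (Suc i)"
      using ss[OF m] that unfolding slotted_def by blast
    finally show ?thesis .
  qed
  ultimately show "plegma L k ss m"
    using ss by (auto simp: plegma_def slotted_def)
qed

text \<open>The bound is the threshold at which slot \<open>k * m + j\<close> opens, so that an
  element of that slot can be appended to \<open>u\<close> as its new maximum.\<close>

lemma slotted_bound:
  assumes T: "mono T" and m: "0 < m" and u: "u \<in> slotted L T m j k"
  shows "u \<subseteq> {..T (k * m + j)}"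
proof
  fix a assume "a \<in> u"
  then obtain i where i: "i < k" "a = elem u i"
    using u elem_cases[of k u a] by (auto simp: slotted_def)
  have "Suc i * m \<le> k * m" using i by (intro mult_le_mono1) simp
  then have "Suc (i * m + j) \<le> k * m + j" using m by simp
  then have "T (Suc (i * m + j)) \<le> T (k * m + j)" using T by (rule monoD[rotated])
  then show "a \<in> {..T (k * m + j)}" using i u by (force simp: slotted_def)
qed

lemma slotted_insert:
  assumes T: "mono T" and m: "0 < m" and u: "u \<in> slotted L T m j k"
    and n: "n \<in> L" "T (k * m + j) < n" "n \<le> T (Suc (k * m + j))"
  shows "insert n u \<in> slotted L T m j (Suc k)"
proof -
  have less: "a < n" if "a \<in> u" for a
    using slotted_bound[OF T m u] that n(2) by force
  have ku: "kset k u" using u by (simp add: slotted_def)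
  have "kset (Suc k) (insert n u)"
    using ku less by (auto simp: kset_def card_insert_if)
  then show ?thesis
    using u n elem_insert_greater[OF ku less] by (auto simp: slotted_def less_Suc_eq)
qed

section \<open>Convex combinations over plegma families close to the weak limit\<close>

lemma convex_hull_finite_subset:
  assumes "z \<in> convex hull A"
  obtains S where "finite S" and "S \<subseteq> A" and "z \<in> convex hull S"
proof -
  obtain S w where "finite S" "S \<subseteq> A" "\<forall>v\<in>S. 0 \<le> w v" "sum w S = 1" "(\<Sum>v\<in>S. w v *\<^sub>R v) = z"
    using assms unfolding convex_hull_explicit by blast
  then show ?thesis
    by (intro that[of S]) (auto simp: convex_hull_finite)
qed

text \<open>The sets \<open>insert n u\<close> converge to \<open>u\<close> as \<open>n\<close>
  grows, so weak continuity and Mazur apply. The resulting convex combination has finite support,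
  which provides \<open>T'\<close>.\<close>

lemma weak_one_point_extension:
  assumes \<phi>: "weakly_continuous_on_le k \<phi>" and L: "infinite L" and \<epsilon>: "0 < \<epsilon>"
    and u: "finite u" "card u < k"
  shows "\<exists>T'. \<exists>z \<in> convex hull ((\<lambda>n. \<phi> (insert n u)) ` (L \<inter> {T<..T'})). norm (\<phi> u - z) < \<epsilon>"
proof -
  define L' where "L' = L \<inter> {T<..}"
  have "L' = L - {..T}" by (auto simp: L'_def)
  then have L': "infinite L'" using L by simp
  define v where "v = Infinite_Set.enumerate L'"
  have v: "v n \<in> L'" "n \<le> v n" for n
    using L' by (auto simp: v_def enumerate_in_set le_enumerate)
  have "\<forall>\<^sub>F n in sequentially. i \<in> insert (v n) u \<longleftrightarrow> i \<in> u" for i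
    using eventually_gt_at_top[of i]
  proof eventually_elim
    case (elim n)
    with v(2)[of n] show ?case by auto
  qed
  moreover have "finite (insert (v n) u) \<and> card (insert (v n) u) \<le> k" for n
    using u card_insert_le_m1[of k u "v n"] by auto
  ultimately have "weakly_converges (\<lambda>n. \<phi> (insert (v n) u)) (\<phi> u)"
    using \<phi>[unfolded weakly_continuous_on_le_def, rule_format,
        where F = "\<lambda>n. insert (v n) u" and G = u] u by simp
  then obtain z where z: "z \<in> convex hull (range (\<lambda>n. \<phi> (insert (v n) u)))" "norm (\<phi> u - z) < \<epsilon>"
    using Mazur_sequence \<epsilon> by blast
  then obtain S where S: "finite S" "S \<subseteq> (\<lambda>n. \<phi> (insert (v n) u)) ` UNIV" "z \<in> convex hull S"
    using convex_hull_finite_subset by metis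
  then obtain N where N: "finite N" "S = (\<lambda>n. \<phi> (insert (v n) u)) ` N"
    by (meson finite_subset_image)
  obtain T' where T': "\<And>n. n \<in> N \<Longrightarrow> v n \<le> T'"
    using N(1) by (metis finite_imageI finite_nat_set_iff_bounded_le imageI)
  have "S \<subseteq> (\<lambda>n. \<phi> (insert n u)) ` (L \<inter> {T<..T'})"
    using T' v(1) by (auto simp: N(2) L'_def)
  then show ?thesis using z(2) S(3) hull_mono by blast
qed

text \<open>Only finitely many \<open>u\<close> live below \<open>T\<close>, so the largest of their
  individual thresholds works for all of them.\<close>

lemma weak_threshold:
  assumes \<phi>: "weakly_continuous_on_le k \<phi>" and L: "infinite L" and \<epsilon>: "0 < \<epsilon>"
  shows "\<exists>T'\<ge>T. \<forall>u. u \<subseteq> {..T} \<longrightarrow> card u < k \<longrightarrow>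
    (\<exists>z \<in> convex hull ((\<lambda>n. \<phi> (insert n u)) ` (L \<inter> {T<..T'})). norm (\<phi> u - z) < \<epsilon>)"
proof -
  define U where "U = {u. u \<subseteq> {..T} \<and> card u < k}"
  have "finite U" unfolding U_def by simp
  have "\<forall>u\<in>U. \<exists>T'. \<exists>z \<in> convex hull ((\<lambda>n. \<phi> (insert n u)) ` (L \<inter> {T<..T'})). norm (\<phi> u - z) < \<epsilon>"
    unfolding U_def using finite_subset[OF _ finite_atMost]
    by (intro ballI weak_one_point_extension[OF \<phi> L \<epsilon>]) auto
  then obtain g where g: "\<And>u. u \<in> U \<Longrightarrow>
      \<exists>z \<in> convex hull ((\<lambda>n. \<phi> (insert n u)) ` (L \<inter> {T<..g u})). norm (\<phi> u - z) < \<epsilon>"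
    by metis
  obtain T0 where T0: "\<And>u. u \<in> U \<Longrightarrow> g u \<le> T0"
    using \<open>finite U\<close> by (metis finite_imageI finite_nat_set_iff_bounded_le imageI)
  have "\<exists>z \<in> convex hull ((\<lambda>n. \<phi> (insert n u)) ` (L \<inter> {T<..max T T0})). norm (\<phi> u - z) < \<epsilon>"
    if "u \<in> U" for u
  proof -
    have "(\<lambda>n. \<phi> (insert n u)) ` (L \<inter> {T<..g u}) \<subseteq> (\<lambda>n. \<phi> (insert n u)) ` (L \<inter> {T<..max T T0})"
      using T0[OF that] by auto
    then show ?thesis using g[OF that] hull_mono by blast
  qed
  then show ?thesis unfolding U_def by (intro exI[of _ "max T T0"]) auto
qed

text \<open>Induction on the number of elements chosen: passing from \<open>\<phi> u\<close> to
  convex combinations of its one-point extensions costs \<epsilon> at each level.\<close>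

lemma slotted_hull_near_limit:
  assumes T: "mono T" and m: "0 < m" and \<epsilon>: "0 < \<epsilon>"
    and step: "\<And>t u. u \<subseteq> {..T t} \<Longrightarrow> card u < k \<Longrightarrow>
      \<exists>z \<in> convex hull ((\<lambda>n. \<phi> (insert n u)) ` (L \<inter> {T t<..T (Suc t)})). norm (\<phi> u - z) < \<epsilon>"
    and "i \<le> k"
  shows "\<exists>z \<in> convex hull (\<phi> ` slotted L T m j i). norm (\<phi> {} - z) \<le> real i * \<epsilon>"
  using \<open>i \<le> k\<close>
proof (induction i)
  case 0
  have "{} \<in> slotted L T m j 0" by (simp add: slotted_def kset_def)
  then have "\<phi> {} \<in> convex hull (\<phi> ` slotted L T m j 0)" by (simp add: hull_inc)
  then show ?case by force
next
  case (Suc i)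
  then obtain z where z: "z \<in> convex hull (\<phi> ` slotted L T m j i)" "norm (\<phi> {} - z) \<le> real i * \<epsilon>"
    by auto
  define K where "K = convex hull (\<phi> ` slotted L T m j (Suc i))"
  \<comment> \<open>Since the \<epsilon>-neighbourhood of the convex set \<open>K\<close> is convex,
    \<open>z \<in> W\<close> only has to be checked at the generators \<open>\<phi> u\<close> of the
    previous level.\<close>
  define W where "W = {w. \<exists>y\<in>K. norm (w - y) \<le> \<epsilon>}"
  have "convex W"
  proof (rule convexI)
    fix w w' and a b :: real
    assume "w \<in> W" "w' \<in> W" and ab: "0 \<le> a" "0 \<le> b" "a + b = 1"
    then obtain y y' where y: "y \<in> K" "y' \<in> K" "norm (w - y) \<le> \<epsilon>" "norm (w' - y') \<le> \<epsilon>"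
      by (auto simp: W_def)
    have "a *\<^sub>R y + b *\<^sub>R y' \<in> K"
      using y ab by (intro convexD) (auto simp: K_def)
    moreover have "norm ((a *\<^sub>R w + b *\<^sub>R w') - (a *\<^sub>R y + b *\<^sub>R y')) \<le> \<epsilon>"
    proof -
      have "(a *\<^sub>R w + b *\<^sub>R w') - (a *\<^sub>R y + b *\<^sub>R y') = a *\<^sub>R (w - y) + b *\<^sub>R (w' - y')"
        by (simp add: algebra_simps)
      also have "norm \<dots> \<le> a * norm (w - y) + b * norm (w' - y')"
        using ab norm_triangle_ineq[of "a *\<^sub>R (w - y)" "b *\<^sub>R (w' - y')"] by simp
      also have "\<dots> \<le> a * \<epsilon> + b * \<epsilon>" using y ab by (intro add_mono mult_left_mono) auto
      also have "\<dots> = \<epsilon>" using ab by (simp add: distrib_right[symmetric])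
      finally show ?thesis .
    qed
    ultimately show "a *\<^sub>R w + b *\<^sub>R w' \<in> W" by (auto simp: W_def)
  qed
  moreover have "\<phi> u \<in> W" if u: "u \<in> slotted L T m j i" for u
  proof -
    have "card u < k" using u Suc.prems by (simp add: slotted_def kset_def)
    then obtain y where
      y: "y \<in> convex hull ((\<lambda>n. \<phi> (insert n u)) ` (L \<inter> {T (i * m + j)<..T (Suc (i * m + j))}))"
        "norm (\<phi> u - y) < \<epsilon>"
      using step slotted_bound[OF T m u] by blast
    have "(\<lambda>n. \<phi> (insert n u)) ` (L \<inter> {T (i * m + j)<..T (Suc (i * m + j))})
        \<subseteq> \<phi> ` slotted L T m j (Suc i)"
      using slotted_insert[OF T m u] by auto
    then have "y \<in> K" using y(1) hull_mono unfolding K_def by blast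
    then show ?thesis using y(2) by (auto simp: W_def intro: less_imp_le)
  qed
  ultimately have "z \<in> W" using z(1) hull_minimal[of "\<phi> ` slotted L T m j i" W convex] by blast
  then obtain y where y: "y \<in> K" "norm (z - y) \<le> \<epsilon>" by (auto simp: W_def)
  have "norm (\<phi> {} - y) \<le> norm (\<phi> {} - z) + norm (z - y)"
    using norm_triangle_ineq[of "\<phi> {} - z" "z - y"] by simp
  also have "\<dots> \<le> real (Suc i) * \<epsilon>" using z(2) y(2) by (simp add: algebra_simps)
  finally show ?case using y(1) unfolding K_def by blast
qed

text \<open>Iterating the threshold function from \<open>l\<close> yields one sequence of slots
  shared by all \<open>m\<close> trees, so a free choice of one set per tree is plegma and starts
  beyond \<open>l\<close>. Each of the \<open>k\<close> levels is allowed an error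
  \<open>\<epsilon> / real k\<close>.\<close>

lemma plegma_trees_near_limit:
  assumes \<phi>: "weakly_continuous_on_le k \<phi>" and L: "infinite L" and \<epsilon>: "0 < \<epsilon>"
    and m: "0 < m" and k: "1 \<le> k"
  obtains G where "\<And>j. j < m \<Longrightarrow> \<exists>z \<in> convex hull (\<phi> ` G j). norm (\<phi> {} - z) \<le> \<epsilon>"
    and "\<And>ss. (\<And>j. j < m \<Longrightarrow> ss j \<in> G j) \<Longrightarrow> plegma L k ss m \<and> l \<le> elem (ss 0) 0"
proof -
  define \<epsilon>' where "\<epsilon>' = \<epsilon> / real k"
  have \<epsilon>': "0 < \<epsilon>'" "real k * \<epsilon>' = \<epsilon>" using \<epsilon> k by (auto simp: \<epsilon>'_def)
  obtain g where g: "\<And>T. T \<le> g T" "\<And>T u. u \<subseteq> {..T} \<Longrightarrow> card u < k \<Longrightarrow>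
      \<exists>z \<in> convex hull ((\<lambda>n. \<phi> (insert n u)) ` (L \<inter> {T<..g T})). norm (\<phi> u - z) < \<epsilon>'"
    using weak_threshold[OF \<phi> L \<epsilon>'(1)] by metis
  define T where "T = (\<lambda>t. (g ^^ t) l)"
  have T: "mono T" using g(1) by (auto simp: T_def mono_iff_le_Suc)
  have "\<exists>z \<in> convex hull (\<phi> ` slotted L T m j k). norm (\<phi> {} - z) \<le> real k * \<epsilon>'" for j
    using g(2)
    by (intro slotted_hull_near_limit[where k = k, OF T m \<epsilon>'(1)]) (auto simp: T_def)
  moreover have "plegma L k ss m \<and> l \<le> elem (ss 0) 0"
    if "\<And>j. j < m \<Longrightarrow> ss j \<in> slotted L T m j k" for ss
    using slotted_plegma[OF T m k that] by (simp add: T_def)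
  ultimately show ?thesis
    using \<epsilon>'(2) by (intro that[of "\<lambda>j. slotted L T m j k"]) auto
qed

text \<open>The coordinates are moved from \<open>A j\<close> into its hull one at a time: with the
  others fixed, the sum is affine in one coordinate, so the preimage \<open>Y\<close> of
  \<open>S\<close> is convex.\<close>

lemma convex_hull_multiaffine:
  fixes z :: "nat \<Rightarrow> 'a::real_vector"
  assumes S: "convex S"
    and base: "\<And>z. (\<And>j. j < m \<Longrightarrow> z j \<in> A j) \<Longrightarrow> (\<Sum>j<m. c j *\<^sub>R z j) \<in> S"
    and z: "\<And>j. j < m \<Longrightarrow> z j \<in> convex hull (A j)"
  shows "(\<Sum>j<m. c j *\<^sub>R z j) \<in> S"
proof -
  have "(\<forall>j<m. z j \<in> (if j < i then convex hull (A j) else A j)) \<longrightarrow> (\<Sum>j<m. c j *\<^sub>R z j) \<in> S"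
    if "i \<le> m" for i z
    using that
  proof (induction i arbitrary: z)
    case 0
    then show ?case using base by auto
  next
    case (Suc i)
    show ?case
    proof
      assume z: "\<forall>j<m. z j \<in> (if j < Suc i then convex hull (A j) else A j)"
      define Y where "Y = {y. (\<Sum>j<m. c j *\<^sub>R (z(i := y)) j) \<in> S}"
      have "A i \<subseteq> Y"
      proof
        fix y assume y: "y \<in> A i"
        have "\<forall>j<m. (z(i := y)) j \<in> (if j < i then convex hull (A j) else A j)"
          using z y by (auto simp: less_Suc_eq split: if_splits)
        then show "y \<in> Y" unfolding Y_def using Suc by simp
      qed
      moreover have "convex Y"
      proof (rule convexI)
        fix y y' and a b :: real
        assume y: "y \<in> Y" "y' \<in> Y" and ab: "0 \<le> a" "0 \<le> b" "a + b = 1"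
        have "(z(i := a *\<^sub>R y + b *\<^sub>R y')) j = a *\<^sub>R (z(i := y)) j + b *\<^sub>R (z(i := y')) j" for j
          using ab by (simp add: scaleR_add_left[symmetric])
        then have "(\<Sum>j<m. c j *\<^sub>R (z(i := a *\<^sub>R y + b *\<^sub>R y')) j) =
            (\<Sum>j<m. a *\<^sub>R (c j *\<^sub>R (z(i := y)) j) + b *\<^sub>R (c j *\<^sub>R (z(i := y')) j))"
          by (intro sum.cong) (simp_all add: scaleR_add_right mult.commute del: fun_upd_apply)
        also have "\<dots> = a *\<^sub>R (\<Sum>j<m. c j *\<^sub>R (z(i := y)) j) + b *\<^sub>R (\<Sum>j<m. c j *\<^sub>R (z(i := y')) j)"
          by (simp add: sum.distrib scaleR_sum_right del: fun_upd_apply)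
        also have "\<dots> \<in> S" using y ab by (intro convexD[OF S]) (auto simp: Y_def)
        finally show "a *\<^sub>R y + b *\<^sub>R y' \<in> Y" by (simp add: Y_def)
      qed
      ultimately have "convex hull (A i) \<subseteq> Y" by (rule hull_minimal)
      moreover have "z i \<in> convex hull (A i)" using z[rule_format, of i] Suc.prems by simp
      ultimately have "z i \<in> Y" by blast
      then show "(\<Sum>j<m. c j *\<^sub>R z j) \<in> S" by (simp add: Y_def del: fun_upd_apply)
    qed
  qed
  from this[of m z] show ?thesis using z by simp
qed

text \<open>This common form of both generating conditions keeps only the convergence of norms along
  far plegma families for fixed coefficients. Being far is measured in the natural numbers and not
  by the enumeration of \<open>M\<close>, so the notion passes to subsets of
  \<open>M\<close>.\<close>

definition plegma_limit ::
  "nat \<Rightarrow> (nat set \<Rightarrow> 'a::real_normed_vector) \<Rightarrow> nat set \<Rightarrow> (nat \<Rightarrow> (nat \<Rightarrow> real) \<Rightarrow> real) \<Rightarrow> bool" where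
  "plegma_limit k x M P \<longleftrightarrow> (\<forall>m a \<eta>. 0 < m \<longrightarrow> 0 < \<eta> \<longrightarrow>
     (\<exists>l. \<forall>ss. plegma M k ss m \<longrightarrow> l \<le> elem (ss 0) 0 \<longrightarrow>
        \<bar>norm (\<Sum>j<m. a j *\<^sub>R x (ss j)) - P m a\<bar> \<le> \<eta>))"

lemma plegma_limitE:
  assumes "plegma_limit k x M P" and "0 < m" and "0 < \<eta>"
  obtains l where "\<And>ss. plegma M k ss m \<Longrightarrow> l \<le> elem (ss 0) 0 \<Longrightarrow>
        \<bar>norm (\<Sum>j<m. a j *\<^sub>R x (ss j)) - P m a\<bar> \<le> \<eta>"
  using assms unfolding plegma_limit_def by meson

lemma plegma_limit_mono:
  "plegma_limit k x M P \<Longrightarrow> L \<subseteq> M \<Longrightarrow> plegma_limit k x L P"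
  unfolding plegma_limit_def using plegma_mono by meson

text \<open>Generating conditions speak of coefficients in \<open>[-1,1]\<close>. General ones are
  divided by \<open>C\<close>, and homogeneity multiplies the error by \<open>C\<close> again,
  whence the demand \<open>\<delta> l < \<eta> / C\<close>.\<close>

lemma plegma_limitI:
  assumes hom: "\<And>m a c. P m (\<lambda>j. c * a j) = \<bar>c\<bar> * P m a"
    and \<delta>: "\<delta> \<longlonglongrightarrow> 0"
    and lim: "\<forall>l m ss a. 1 \<le> l \<longrightarrow> m \<le> l \<longrightarrow> plegma M k ss m \<longrightarrow> 0 < m \<longrightarrow>
           Mel M (l - 1) \<le> elem (ss 0) 0 \<longrightarrow> (\<forall>j<m. \<bar>a j\<bar> \<le> 1) \<longrightarrow>
           \<bar>norm (\<Sum>j<m. a j *\<^sub>R x (ss j)) - P m a\<bar> \<le> \<delta> l"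
  shows "plegma_limit k x M P"
  unfolding plegma_limit_def
proof (intro allI impI)
  fix m :: nat and a :: "nat \<Rightarrow> real" and \<eta> :: real
  assume m: "0 < m" and \<eta>: "0 < \<eta>"
  define C where "C = 1 + (\<Sum>j<m. \<bar>a j\<bar>)"
  have C: "0 < C" unfolding C_def by (simp add: add_pos_nonneg sum_nonneg)
  have a: "\<bar>inverse C * a j\<bar> \<le> 1" if "j < m" for j
  proof -
    have "\<bar>a j\<bar> \<le> (\<Sum>j<m. \<bar>a j\<bar>)" using that by (intro member_le_sum) auto
    then have "\<bar>a j\<bar> \<le> C" by (simp add: C_def)
    then show ?thesis using C by (simp add: abs_mult field_simps)
  qed
  have "\<forall>\<^sub>F l in sequentially. m \<le> l \<and> \<bar>\<delta> l\<bar> < \<eta> / C"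
    using eventually_ge_at_top[of m] tendstoD[OF \<delta>, of "\<eta> / C"] \<eta> C
    by (auto simp: eventually_conj_iff)
  then obtain l where l: "m \<le> l" "\<delta> l < \<eta> / C"
    by (auto simp: eventually_sequentially abs_less_iff)
  show "\<exists>l. \<forall>ss. plegma M k ss m \<longrightarrow> l \<le> elem (ss 0) 0 \<longrightarrow>
        \<bar>norm (\<Sum>j<m. a j *\<^sub>R x (ss j)) - P m a\<bar> \<le> \<eta>"
  proof (intro exI allI impI)
    fix ss assume ss: "plegma M k ss m" "Mel M (l - 1) \<le> elem (ss 0) 0"
    have "\<bar>norm (\<Sum>j<m. (inverse C * a j) *\<^sub>R x (ss j)) - P m (\<lambda>j. inverse C * a j)\<bar> \<le> \<delta> l"
      using lim[rule_format, of l m ss "\<lambda>j. inverse C * a j"] l(1) ss a m by auto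
    also have "(\<Sum>j<m. (inverse C * a j) *\<^sub>R x (ss j)) = inverse C *\<^sub>R (\<Sum>j<m. a j *\<^sub>R x (ss j))"
      by (simp add: scaleR_sum_right)
    also have "norm \<dots> - P m (\<lambda>j. inverse C * a j) = inverse C * (norm (\<Sum>j<m. a j *\<^sub>R x (ss j)) - P m a)"
      using C unfolding hom by (simp add: algebra_simps)
    finally have "inverse C * \<bar>norm (\<Sum>j<m. a j *\<^sub>R x (ss j)) - P m a\<bar> \<le> \<eta> / C"
      using C l(2) by (simp add: abs_mult)
    then show "\<bar>norm (\<Sum>j<m. a j *\<^sub>R x (ss j)) - P m a\<bar> \<le> \<eta>" using C by (simp add: field_simps)
  qed
qed

lemma generates_ksm_plegma_limit:
  assumes "generates_ksm k x M e"
  shows "plegma_limit k x M (\<lambda>m a. norm (\<Sum>j<m. a j *\<^sub>R e j))"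
proof -
  have "norm (\<Sum>j<m. (c * a j) *\<^sub>R e j) = \<bar>c\<bar> * norm (\<Sum>j<m. a j *\<^sub>R e j)" for m a c
    by (simp flip: scaleR_scaleR scaleR_sum_right)
  then show ?thesis
    using assms unfolding generates_ksm_def by (auto intro: plegma_limitI)
qed

lemma finsupp_trunc: "finsupp (trunc m a)"
  unfolding finsupp_def trunc_def by (rule finite_subset[of _ "{..<m}"]) auto

lemma generates_ksm_sn_plegma_limit:
  assumes "generates_ksm_sn k x M p"
  shows "plegma_limit k x M (\<lambda>m a. p (trunc m a))"
proof -
  have "trunc m (\<lambda>j. c * a j) = (\<lambda>j. c * trunc m a j)" for m a and c :: real
    by (auto simp: trunc_def)
  then have "p (trunc m (\<lambda>j. c * a j)) = \<bar>c\<bar> * p (trunc m a)" for m a c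
    using assms finsupp_trunc unfolding generates_ksm_sn_def is_seminorm_def by metis
  then show ?thesis
    using assms unfolding generates_ksm_sn_def by (auto intro: plegma_limitI)
qed

text \<open>The terms with index outside \<open>H\<close> are averaged, within a plegma family, to their weak limit.\<close>

lemma plegma_averaging:
  assumes k: "1 \<le> k" and sub: "subordinated_weak k x x0" and lim: "plegma_limit k x M P"
    and L: "infinite L" "L \<subseteq> M" and m: "0 < m" and \<eta>: "0 < \<eta>"
  obtains ss where "plegma L k ss m" and "l \<le> elem (ss 0) 0"
    and "norm (\<Sum>j<m. c j *\<^sub>R (if j \<in> H then x (ss j) else x0)) \<le> P m c + \<eta>"
proof -
  obtain \<phi> where \<phi>: "\<And>s. kset k s \<Longrightarrow> \<phi> s = x s" "weakly_continuous_on_le k \<phi>" "\<phi> {} = x0"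
    using sub by (auto simp: subordinated_weak_def)
  obtain l1 where l1: "\<And>ss. plegma L k ss m \<Longrightarrow> l1 \<le> elem (ss 0) 0 \<Longrightarrow>
        \<bar>norm (\<Sum>j<m. c j *\<^sub>R x (ss j)) - P m c\<bar> \<le> \<eta> / 2"
    using plegma_limitE[OF plegma_limit_mono[OF lim L(2)] m, of "\<eta> / 2"] \<eta> by auto
  define C where "C = 1 + (\<Sum>j<m. \<bar>c j\<bar>)"
  have C: "0 < C" unfolding C_def by (simp add: add_pos_nonneg sum_nonneg)
  \<comment> \<open>Half of \<eta> pays for the limit \<open>P m c\<close>; the other half pays for
    replacing each \<open>w j\<close> by \<open>x0\<close>, which costs at most
    \<open>C * \<epsilon>\<close>.\<close>
  define \<epsilon> where "\<epsilon> = \<eta> / (2 * C)"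
  have \<epsilon>: "0 < \<epsilon>" "C * \<epsilon> = \<eta> / 2" using \<eta> C by (auto simp: \<epsilon>_def)
  obtain G where G: "\<And>j. j < m \<Longrightarrow> \<exists>z \<in> convex hull (\<phi> ` G j). norm (\<phi> {} - z) \<le> \<epsilon>"
    and Gp: "\<And>ss. (\<And>j. j < m \<Longrightarrow> ss j \<in> G j) \<Longrightarrow> plegma L k ss m \<and> max l l1 \<le> elem (ss 0) 0"
    using plegma_trees_near_limit[OF \<phi>(2) L(1) \<epsilon>(1) m k, of "max l l1"] by blast
  obtain w where w: "\<And>j. j < m \<Longrightarrow> w j \<in> convex hull (\<phi> ` G j)" "\<And>j. j < m \<Longrightarrow> norm (x0 - w j) \<le> \<epsilon>"
    using G \<phi>(3) by metis
  have "\<exists>s. s \<in> G j" if "j < m" for j using w(1)[OF that] by (cases "G j = {}") auto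
  then obtain ss where ss: "\<And>j. j < m \<Longrightarrow> ss j \<in> G j" by metis
  define z where "z = (\<lambda>j. if j \<in> H then \<phi> (ss j) else w j)"
  \<comment> \<open>The ball is convex, so the bound need only be tested when every coordinate comes
    from an actual set of its tree. All such choices are plegma and far out.\<close>
  have "(\<Sum>j<m. c j *\<^sub>R z j) \<in> cball 0 (P m c + \<eta> / 2)"
  proof (rule convex_hull_multiaffine)
    fix y assume "\<And>j. j < m \<Longrightarrow> y j \<in> \<phi> ` G j"
    then obtain tt where tt: "\<And>j. j < m \<Longrightarrow> tt j \<in> G j \<and> y j = \<phi> (tt j)"
      unfolding image_iff by metis
    then have pl: "plegma L k tt m" "l1 \<le> elem (tt 0) 0" using Gp[of tt] by auto
    then have "(\<Sum>j<m. c j *\<^sub>R y j) = (\<Sum>j<m. c j *\<^sub>R x (tt j))"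
      using tt \<phi>(1) by (intro sum.cong) (auto simp: plegma_def)
    then show "(\<Sum>j<m. c j *\<^sub>R y j) \<in> cball 0 (P m c + \<eta> / 2)"
      using l1[OF pl] unfolding mem_cball_0 by (simp only:)
  next
    show "z j \<in> convex hull (\<phi> ` G j)" if "j < m" for j
      using ss w(1) that by (auto simp: z_def hull_inc)
  qed simp
  then have z: "norm (\<Sum>j<m. c j *\<^sub>R z j) \<le> P m c + \<eta> / 2" by simp
  have pl: "plegma L k ss m" "l \<le> elem (ss 0) 0" using Gp[OF ss] by auto
  define y where "y = (\<lambda>j. if j \<in> H then x (ss j) else x0)"
  have yz: "norm (y j - z j) \<le> \<epsilon>" if "j < m" for j
    using pl(1) that w(2)[OF that] \<phi>(1) \<epsilon>(1) by (auto simp: y_def z_def plegma_def)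
  have "norm ((\<Sum>j<m. c j *\<^sub>R y j) - (\<Sum>j<m. c j *\<^sub>R z j)) = norm (\<Sum>j<m. c j *\<^sub>R (y j - z j))"
    by (simp add: sum_subtractf scaleR_diff_right)
  also have "\<dots> \<le> (\<Sum>j<m. \<bar>c j\<bar> * \<epsilon>)"
    using yz by (intro sum_norm_le) (auto intro: mult_left_mono)
  also have "\<dots> \<le> C * \<epsilon>" using \<epsilon>(1) by (simp add: C_def distrib_right flip: sum_distrib_right)
  finally have "norm (\<Sum>j<m. c j *\<^sub>R y j) \<le> P m c + \<eta>"
    using z \<epsilon>(2) norm_triangle_ineq2[of "\<Sum>j<m. c j *\<^sub>R y j" "\<Sum>j<m. c j *\<^sub>R z j"] by linarith
  then show ?thesis using that pl unfolding y_def by blast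
qed

section \<open>Sequences equivalent to the basis of \<open>\<ell>\<^sup>1\<close>\<close>

lemma eq_if_abs_diff_le_mult:
  fixes u v :: real
  assumes "\<And>\<eta>. 0 < \<eta> \<Longrightarrow> \<bar>u - v\<bar> \<le> K * \<eta>"
  shows "u = v"
proof -
  have K: "0 \<le> K" using assms[of 1] by simp
  have "\<bar>u - v\<bar> \<le> 0 + \<epsilon>" if "0 < \<epsilon>" for \<epsilon>
  proof -
    have "\<bar>u - v\<bar> \<le> K * (\<epsilon> / (K + 1))" using that K by (intro assms) simp
    also have "\<dots> \<le> \<epsilon>" using that K by (simp add: field_simps)
    finally show ?thesis by simp
  qed
  then show ?thesis using field_le_epsilon[of "\<bar>u - v\<bar>" 0] by simp
qed

lemma abs_diff_chain:
  fixes p q r s t :: real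
  assumes "\<bar>q - p\<bar> \<le> a" and "\<bar>q - r\<bar> \<le> b" and "\<bar>r - s\<bar> \<le> c" and "\<bar>t - s\<bar> \<le> d"
  shows "\<bar>p - t\<bar> \<le> a + b + c + d"
  using assms by linarith

lemma span_range_nat:
  fixes e :: "nat \<Rightarrow> 'a::real_vector"
  assumes "y \<in> span (range e)"
  shows "\<exists>m a. (\<forall>j\<ge>m. a j = 0) \<and> y = (\<Sum>j<m. a j *\<^sub>R e j)"
  using assms
proof (induction rule: span_induct_alt)
  case base
  show ?case by (intro exI[of _ 0] exI[of _ "\<lambda>_. 0"]) simp
next
  case (step c z y)
  then obtain i m a where i: "z = e i" and a: "\<And>j. j \<ge> m \<Longrightarrow> a j = 0" "y = (\<Sum>j<m. a j *\<^sub>R e j)"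
    by auto
  define n where "n = max m (Suc i)"
  define b where "b = (\<lambda>j. (if j = i then c else 0) + a j)"
  have "i < n" by (simp add: n_def)
  have "y = (\<Sum>j<n. a j *\<^sub>R e j)"
    unfolding a(2) by (intro sum.mono_neutral_left) (auto simp: n_def a(1))
  moreover have "c *\<^sub>R z = (\<Sum>j<n. (if j = i then c else 0) *\<^sub>R e j)"
    using \<open>i < n\<close> by (simp add: i if_distrib[of "\<lambda>t. t *\<^sub>R _"] cong: if_cong)
  ultimately have "c *\<^sub>R z + y = (\<Sum>j<n. b j *\<^sub>R e j)"
    by (simp add: b_def sum.distrib scaleR_add_left)
  moreover have "\<forall>j\<ge>n. b j = 0" using a(1) by (auto simp: b_def n_def)
  ultimately show ?case by blast
qed

text \<open>By the lower estimate the coefficients of approximants from the span are Cauchy in the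
  \<ell>1 norm; the upper estimate shows that their coordinatewise limit expands \<open>y\<close>.
  Uniqueness is the lower estimate again.\<close>

lemma l1_equiv_imp_schauder_basic:
  fixes e :: "nat \<Rightarrow> 'b::banach"
  assumes "l1_equiv e"
  shows "schauder_basic e"
  unfolding schauder_basic_def
proof
  obtain c C where c: "0 < c"
    and low: "\<And>m a. c * (\<Sum>j<m. \<bar>a j\<bar>) \<le> norm (\<Sum>j<m. a j *\<^sub>R e j)"
    and up: "\<And>m a. norm (\<Sum>j<m. a j *\<^sub>R e j) \<le> C * (\<Sum>j<m. \<bar>a j\<bar>)"
    using assms unfolding l1_equiv_def by blast
  have C: "0 \<le> C" using up[of "\<lambda>_. 1" 1] order_trans[OF norm_ge_zero[of "e 0"]] by simp
  fix y assume "y \<in> closure (span (range e))"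
  then obtain u where u: "\<And>i. u i \<in> span (range e)" "u \<longlonglongrightarrow> y"
    unfolding closure_sequential by blast
  obtain m a where ma: "\<And>i j. m i \<le> j \<Longrightarrow> a i j = 0" "\<And>i. u i = (\<Sum>j<m i. a i j *\<^sub>R e j)"
    using span_range_nat[OF u(1)] by metis
  have u_eq: "u i = (\<Sum>j<n. a i j *\<^sub>R e j)" if "m i \<le> n" for i n
    unfolding ma(2) using that by (intro sum.mono_neutral_left) (auto simp: ma(1))
  have diff: "c * (\<Sum>j<n. \<bar>a i j - a i' j\<bar>) \<le> norm (u i - u i')" for i i' n
  proof -
    define n' where "n' = max n (max (m i) (m i'))"
    have "(\<Sum>j<n. \<bar>a i j - a i' j\<bar>) \<le> (\<Sum>j<n'. \<bar>a i j - a i' j\<bar>)"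
      by (intro sum_mono2) (auto simp: n'_def)
    then have "c * (\<Sum>j<n. \<bar>a i j - a i' j\<bar>) \<le> c * (\<Sum>j<n'. \<bar>a i j - a i' j\<bar>)" using c by simp
    also have "\<dots> \<le> norm (\<Sum>j<n'. (a i j - a i' j) *\<^sub>R e j)" by (rule low)
    also have "(\<Sum>j<n'. (a i j - a i' j) *\<^sub>R e j) = u i - u i'"
      using u_eq[of i n'] u_eq[of i' n'] by (simp add: n'_def scaleR_diff_left sum_subtractf)
    finally show ?thesis .
  qed
  have Cauchy_u: "\<exists>I. \<forall>i\<ge>I. \<forall>i'\<ge>I. norm (u i - u i') < \<epsilon>" if "0 < \<epsilon>" for \<epsilon>
    using LIMSEQ_imp_Cauchy[OF u(2)] that unfolding Cauchy_def dist_norm by blast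
  have "Cauchy (\<lambda>i. a i j)" for j
    unfolding Cauchy_def dist_norm
  proof (intro allI impI)
    fix \<epsilon> :: real assume \<epsilon>: "0 < \<epsilon>"
    then obtain I where I: "\<And>i i'. i \<ge> I \<Longrightarrow> i' \<ge> I \<Longrightarrow> norm (u i - u i') < c * \<epsilon>"
      using Cauchy_u[of "c * \<epsilon>"] c by auto
    have "norm (a i j - a i' j) < \<epsilon>" if "i \<ge> I" "i' \<ge> I" for i i'
    proof -
      have "c * \<bar>a i j - a i' j\<bar> \<le> c * (\<Sum>j<Suc j. \<bar>a i j - a i' j\<bar>)"
        using c by (simp add: sum_nonneg)
      also have "\<dots> < c * \<epsilon>" using diff[of i i' "Suc j"] I[OF that] by linarith
      finally show ?thesis using c by simp
    qed
    then show "\<exists>I. \<forall>i\<ge>I. \<forall>i'\<ge>I. norm (a i j - a i' j) < \<epsilon>" by blast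
  qed
  then have "\<exists>l. (\<lambda>i. a i j) \<longlonglongrightarrow> l" for j by (simp add: Cauchy_convergent_iff convergent_def)
  then obtain b where b: "\<And>j. (\<lambda>i. a i j) \<longlonglongrightarrow> b j" by metis
  have "(\<lambda>n. \<Sum>j<n. b j *\<^sub>R e j) \<longlonglongrightarrow> y"
  proof (rule LIMSEQ_I)
    fix \<epsilon> :: real assume \<epsilon>: "0 < \<epsilon>"
    \<comment> \<open>Approximants within \<gamma> have coefficients within
      \<open>\<gamma> / c\<close> in the \<ell>1 norm, and the upper estimate turns this into at
      most \<open>\<epsilon> / 2\<close>. Using \<open>C + 1\<close> gives a positive denominator
      from \<open>0 \<le> C\<close>.\<close>
    define \<gamma> where "\<gamma> = c * \<epsilon> / (2 * (C + 1))"
    have \<gamma>: "0 < \<gamma>" using \<epsilon> c C by (simp add: \<gamma>_def)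
    have "C * (\<gamma> / c) = \<epsilon> / 2 * (C / (C + 1))" using c by (simp add: \<gamma>_def)
    also have "\<dots> \<le> \<epsilon> / 2 * 1" using C \<epsilon> by (intro mult_left_mono) auto
    finally have C\<gamma>: "C * (\<gamma> / c) \<le> \<epsilon> / 2" by simp
    obtain I where I: "\<And>i i'. i \<ge> I \<Longrightarrow> i' \<ge> I \<Longrightarrow> norm (u i - u i') < \<gamma>"
      using Cauchy_u[OF \<gamma>] by blast
    obtain I' where I': "\<And>i. i \<ge> I' \<Longrightarrow> norm (u i - y) < \<epsilon> / 2"
      using LIMSEQ_D[OF u(2), of "\<epsilon> / 2"] \<epsilon> by auto
    define i where "i = max I I'"
    have "norm ((\<Sum>j<n. b j *\<^sub>R e j) - y) < \<epsilon>" if n: "m i \<le> n" for n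
    proof -
      have "(\<lambda>i'. c * (\<Sum>j<n. \<bar>a i j - a i' j\<bar>)) \<longlonglongrightarrow> c * (\<Sum>j<n. \<bar>a i j - b j\<bar>)"
        by (intro tendsto_intros b)
      moreover have "\<forall>i'\<ge>I. c * (\<Sum>j<n. \<bar>a i j - a i' j\<bar>) \<le> \<gamma>"
        using diff[of i _ n] I[of i] by (force simp: i_def intro: less_imp_le le_less_trans)
      ultimately have "c * (\<Sum>j<n. \<bar>a i j - b j\<bar>) \<le> \<gamma>"
        by (intro LIMSEQ_le_const2) auto
      then have "(\<Sum>j<n. \<bar>b j - a i j\<bar>) \<le> \<gamma> / c"
        using c by (simp add: field_simps abs_minus_commute)
      then have "norm (\<Sum>j<n. (b j - a i j) *\<^sub>R e j) \<le> C * (\<gamma> / c)"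
        using up[of "\<lambda>j. b j - a i j" n] C by (meson mult_left_mono order_trans)
      moreover have "(\<Sum>j<n. b j *\<^sub>R e j) - y = (\<Sum>j<n. (b j - a i j) *\<^sub>R e j) + (u i - y)"
        unfolding u_eq[OF n] by (simp add: scaleR_diff_left sum_subtractf)
      ultimately have "norm ((\<Sum>j<n. b j *\<^sub>R e j) - y) \<le> C * (\<gamma> / c) + norm (u i - y)"
        by (metis norm_triangle_mono order_refl)
      moreover have "norm (u i - y) < \<epsilon> / 2" using I' by (simp add: i_def)
      ultimately show ?thesis using C\<gamma> by linarith
    qed
    then show "\<exists>n0. \<forall>n\<ge>n0. norm ((\<Sum>j<n. b j *\<^sub>R e j) - y) < \<epsilon>" by blast
  qed
  then have "(\<lambda>n. b n *\<^sub>R e n) sums y" by (simp add: sums_def)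
  moreover have "a = b" if ab: "(\<lambda>n. a n *\<^sub>R e n) sums y" "(\<lambda>n. b n *\<^sub>R e n) sums y" for a b
  proof
    fix i
    have "(\<lambda>n. (a n - b n) *\<^sub>R e n) sums 0"
      using sums_diff[OF ab] by (simp add: scaleR_diff_left)
    then have "(\<lambda>n. norm (\<Sum>j<n. (a j - b j) *\<^sub>R e j)) \<longlonglongrightarrow> 0"
      unfolding sums_def by (rule tendsto_norm_zero)
    moreover have "\<forall>n\<ge>Suc i. c * \<bar>a i - b i\<bar> \<le> norm (\<Sum>j<n. (a j - b j) *\<^sub>R e j)"
    proof (intro allI impI)
      fix n assume "Suc i \<le> n"
      then have "\<bar>a i - b i\<bar> \<le> (\<Sum>j<n. \<bar>a j - b j\<bar>)" by (intro member_le_sum) auto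
      then have "c * \<bar>a i - b i\<bar> \<le> c * (\<Sum>j<n. \<bar>a j - b j\<bar>)" using c by simp
      then show "c * \<bar>a i - b i\<bar> \<le> norm (\<Sum>j<n. (a j - b j) *\<^sub>R e j)" by (rule order_trans[OF _ low])
    qed
    ultimately have "c * \<bar>a i - b i\<bar> \<le> 0" by (intro LIMSEQ_le_const) auto
    then show "a i = b i" using c by (simp add: mult_le_0_iff)
  qed
  ultimately show "\<exists>!a. (\<lambda>n. a n *\<^sub>R e n) sums y" by blast
qed

section \<open>Concatenation and extension of coefficient sequences\<close>

definition concat_at :: "nat \<Rightarrow> (nat \<Rightarrow> real) \<Rightarrow> (nat \<Rightarrow> real) \<Rightarrow> nat \<Rightarrow> real" where
  "concat_at r a b j = (if j < r then a j else b (j - r))"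

lemma sum_concat_at:
  fixes f :: "nat \<Rightarrow> 'a::real_vector"
  shows "(\<Sum>j<r + m. concat_at r a b j *\<^sub>R f j) = (\<Sum>j<r. a j *\<^sub>R f j) + (\<Sum>j<m. b j *\<^sub>R f (r + j))"
  by (induction m) (simp_all add: concat_at_def)

lemma sum_extend:
  fixes f :: "nat \<Rightarrow> 'c::real_vector"
  assumes "\<And>j. n \<le> j \<Longrightarrow> c j = 0" and "n \<le> n'"
  shows "(\<Sum>j<n'. c j *\<^sub>R f j) = (\<Sum>j<n. c j *\<^sub>R f j)"
  using assms by (intro sum.mono_neutral_right) auto

lemma seminorm_trunc_0:
  assumes "is_seminorm p"
  shows "p (trunc 0 a) = 0"
proof -
  have "p (\<lambda>j. 0 * trunc 0 a j) = \<bar>0\<bar> * p (trunc 0 a)"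
    using assms[unfolded is_seminorm_def, THEN conjunct2] finsupp_trunc by blast
  moreover have "(\<lambda>j. 0 * trunc 0 a j) = trunc 0 a" by (auto simp: trunc_def)
  ultimately show ?thesis by simp
qed

section \<open>The dichotomy\<close>

locale weak_ksm =
  fixes k :: nat and x :: "nat set \<Rightarrow> 'a::banach" and x0 :: 'a and M :: "nat set"
    and e :: "nat \<Rightarrow> 'b::banach"
  assumes k: "1 \<le> k" and subordinated: "subordinated_weak k x x0" and M: "infinite M"
    and limit: "plegma_limit k x M (\<lambda>m a. norm (\<Sum>j<m. a j *\<^sub>R e j))"
    and x0: "x0 \<noteq> 0"
begin

section \<open>Norm estimates for the spreading model and for averaged differences\<close>

lemma far_plegma:
  assumes "infinite L" and "L \<subseteq> M" and "0 < m"
  obtains ss where "plegma L k ss m" and "l \<le> elem (ss 0) 0"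
  \<comment> \<open>With zero coefficients, averaging merely asserts that far plegma families
    exist.\<close>
  by (rule plegma_averaging[where l = l and c = "\<lambda>_. 0" and H = "{}",
        OF k subordinated limit assms zero_less_one]) (rule that)

text \<open>Both norms are limits along the same far family of \<open>r + m\<close> sets, since its
  last \<open>m\<close> sets are themselves a far plegma family.\<close>

lemma norm_shift: "norm (\<Sum>j<m. a j *\<^sub>R e (r + j)) = norm (\<Sum>j<m. a j *\<^sub>R e j)"
proof (cases "m = 0")
  case False
  then have m: "0 < m" by simp
  define a' where "a' = concat_at r (\<lambda>_. 0) a"
  show ?thesis
  proof (rule eq_if_abs_diff_le_mult[where K = 2])
    fix \<eta> :: real assume \<eta>: "0 < \<eta>"
    obtain l1 where l1: "\<And>ss. plegma M k ss (r + m) \<Longrightarrow> l1 \<le> elem (ss 0) 0 \<Longrightarrow>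
        \<bar>norm (\<Sum>j<r + m. a' j *\<^sub>R x (ss j)) - norm (\<Sum>j<r + m. a' j *\<^sub>R e j)\<bar> \<le> \<eta>"
      using plegma_limitE[OF limit, of "r + m" \<eta>] m \<eta> by auto
    obtain l2 where l2: "\<And>ss. plegma M k ss m \<Longrightarrow> l2 \<le> elem (ss 0) 0 \<Longrightarrow>
        \<bar>norm (\<Sum>j<m. a j *\<^sub>R x (ss j)) - norm (\<Sum>j<m. a j *\<^sub>R e j)\<bar> \<le> \<eta>"
      using plegma_limitE[OF limit m \<eta>] by auto
    obtain ss where ss: "plegma M k ss (r + m)" "max l1 l2 \<le> elem (ss 0) 0"
      using far_plegma[OF M order_refl, of "r + m" "max l1 l2"] m by (metis add_gr_0)
    have "plegma M k (\<lambda>j. ss (r + j)) m" "elem (ss 0) 0 \<le> elem (ss r) 0"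
      using plegma_interval[OF ss(1) _ m k, of r] by auto
    then have "\<bar>norm (\<Sum>j<m. a j *\<^sub>R x (ss (r + j))) - norm (\<Sum>j<m. a j *\<^sub>R e j)\<bar> \<le> \<eta>"
      using l2[of "\<lambda>j. ss (r + j)"] ss(2) by auto
    moreover have "\<bar>norm (\<Sum>j<m. a j *\<^sub>R x (ss (r + j))) - norm (\<Sum>j<m. a j *\<^sub>R e (r + j))\<bar> \<le> \<eta>"
      using l1[OF ss(1)] ss(2) by (simp add: a'_def sum_concat_at)
    ultimately show "\<bar>norm (\<Sum>j<m. a j *\<^sub>R e (r + j)) - norm (\<Sum>j<m. a j *\<^sub>R e j)\<bar> \<le> 2 * \<eta>"
      by linarith
  qed
qed simp

lemma norm_e: "norm (e j) = norm (e 0)"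
  using norm_shift[of "\<lambda>_. 1" j 1] by simp

lemma norm_le_l1: "norm (\<Sum>j<m. a j *\<^sub>R e j) \<le> norm (e 0) * (\<Sum>j<m. \<bar>a j\<bar>)"
proof -
  have "norm (\<Sum>j<m. a j *\<^sub>R e j) \<le> (\<Sum>j<m. \<bar>a j\<bar> * norm (e 0))"
    by (intro sum_norm_le) (metis norm_e norm_scaleR order_refl)
  then show ?thesis by (simp add: sum_distrib_left mult.commute)
qed

text \<open>With \<open>H\<close> empty every term is averaged to \<open>x0\<close>, and the sum
  becomes \<open>(\<Sum>j<m. c j) *\<^sub>R x0\<close>.\<close>

lemma sum_le_norm: "\<bar>\<Sum>j<m. c j\<bar> * norm x0 \<le> norm (\<Sum>j<m. c j *\<^sub>R e j)"
proof (cases "m = 0")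
  case False
  show ?thesis
  proof (rule field_le_epsilon)
    fix \<eta> :: real assume "0 < \<eta>"
    then obtain ss where
      "norm (\<Sum>j<m. c j *\<^sub>R (if j \<in> {} then x (ss j) else x0)) \<le> norm (\<Sum>j<m. c j *\<^sub>R e j) + \<eta>"
      using plegma_averaging[OF k subordinated limit M order_refl, of m \<eta> _ c "{}"] False by blast
    then show "\<bar>\<Sum>j<m. c j\<bar> * norm x0 \<le> norm (\<Sum>j<m. c j *\<^sub>R e j) + \<eta>"
      by (simp flip: scaleR_sum_left)
  qed
qed simp

text \<open>Averaging the terms outside \<open>H\<close> and then subtracting
  \<open>(\<Sum>j<m. c j) *\<^sub>R x0\<close> leaves exactly the differences on \<open>H\<close>.
  Both parts are controlled by the norm of the model vector, hence the factor 2.\<close>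

lemma restricted_averaging:
  assumes L: "infinite L" "L \<subseteq> M" and m: "0 < m" and \<eta>: "0 < \<eta>"
  obtains ss where "plegma L k ss m" and "l \<le> elem (ss 0) 0"
    and "norm (\<Sum>j<m. (if j \<in> H then c j else 0) *\<^sub>R (x (ss j) - x0))
      \<le> 2 * norm (\<Sum>j<m. c j *\<^sub>R e j) + \<eta>"
proof -
  obtain ss where ss: "plegma L k ss m" "l \<le> elem (ss 0) 0"
    "norm (\<Sum>j<m. c j *\<^sub>R (if j \<in> H then x (ss j) else x0)) \<le> norm (\<Sum>j<m. c j *\<^sub>R e j) + \<eta>"
    using plegma_averaging[OF k subordinated limit L m \<eta>] by blast
  have "(\<Sum>j<m. (if j \<in> H then c j else 0) *\<^sub>R (x (ss j) - x0)) =
      (\<Sum>j<m. c j *\<^sub>R (if j \<in> H then x (ss j) else x0) - c j *\<^sub>R x0)"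
    by (intro sum.cong) (auto simp: scaleR_diff_right)
  also have "\<dots> = (\<Sum>j<m. c j *\<^sub>R (if j \<in> H then x (ss j) else x0)) - (\<Sum>j<m. c j) *\<^sub>R x0"
    by (simp add: sum_subtractf scaleR_sum_left)
  also have "norm \<dots> \<le> norm (\<Sum>j<m. c j *\<^sub>R (if j \<in> H then x (ss j) else x0)) + \<bar>\<Sum>j<m. c j\<bar> * norm x0"
    using norm_triangle_ineq4[of "\<Sum>j<m. c j *\<^sub>R (if j \<in> H then x (ss j) else x0)" "(\<Sum>j<m. c j) *\<^sub>R x0"]
    by simp
  finally show ?thesis using ss sum_le_norm[of c m] by (intro that[OF ss(1,2)]) linarith
qed

text \<open>If \<open>e\<close> is not equivalent to the basis of \<open>\<ell>\<^sup>1\<close>, blocks exist arbitrarily far out with \<open>\<beta>\<close>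
  arbitrarily small, and they converge in norm to the weak limit of the spreading model.\<close>

definition block :: "real \<Rightarrow> nat \<Rightarrow> nat \<Rightarrow> (nat \<Rightarrow> real) \<Rightarrow> bool" where
  "block \<beta> r n b \<longleftrightarrow> (\<exists>c H. (\<forall>j. b j = (if j \<in> H then c j else 0)) \<and>
     (\<forall>j. j < r \<or> n \<le> j \<longrightarrow> c j = 0) \<and> norm (\<Sum>j<n. c j *\<^sub>R e j) \<le> \<beta> \<and>
     (\<forall>j. 0 \<le> b j) \<and> (\<Sum>j<n. b j) = 1)"

lemma block_source:
  assumes "block \<beta> r n b"
  shows "\<exists>c H. b = (\<lambda>j. if j \<in> H then c j else 0) \<and> (\<forall>j<r. c j = 0) \<and> (\<forall>j\<ge>n. c j = 0) \<and>
    norm (\<Sum>j<n. c j *\<^sub>R e j) \<le> \<beta>"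
proof -
  obtain c H where "\<forall>j. b j = (if j \<in> H then c j else 0)" "\<forall>j. j < r \<or> n \<le> j \<longrightarrow> c j = 0"
    "norm (\<Sum>j<n. c j *\<^sub>R e j) \<le> \<beta>"
    using assms unfolding block_def by blast
  then show ?thesis by (intro exI[of _ c] exI[of _ H]) auto
qed

lemma block_facts:
  assumes "block \<beta> r n b"
  shows "0 \<le> b j" and "(\<Sum>j<n. b j) = 1" and "j < r \<Longrightarrow> b j = 0" and "n \<le> j \<Longrightarrow> b j = 0"
    and "r < n"
proof -
  show z: "0 \<le> b j" "(\<Sum>j<n. b j) = 1" "j < r \<Longrightarrow> b j = 0" "n \<le> j \<Longrightarrow> b j = 0" for j
    using assms unfolding block_def by auto
  show "r < n"
  proof (rule ccontr)
    assume "\<not> r < n"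
    then have "(\<Sum>j<n. b j) = 0" using z(3) by (intro sum.neutral) auto
    then show False using z(2) by simp
  qed
qed

lemma block_start_mono:
  assumes "block \<beta> r n b" and "r' \<le> r"
  shows "block \<beta> r' n b"
proof -
  obtain c H where "\<forall>j. b j = (if j \<in> H then c j else 0)" "\<forall>j. j < r \<or> n \<le> j \<longrightarrow> c j = 0"
    "norm (\<Sum>j<n. c j *\<^sub>R e j) \<le> \<beta>" "\<forall>j. 0 \<le> b j" "(\<Sum>j<n. b j) = 1"
    using assms(1) unfolding block_def by blast
  moreover from this(2) have "\<forall>j. j < r' \<or> n \<le> j \<longrightarrow> c j = 0"
    using assms(2) by auto
  ultimately show ?thesis unfolding block_def by blast
qed

lemma block_averaging:
  assumes b: "block \<beta> r n b" and L: "infinite L" "L \<subseteq> M" and \<eta>: "0 < \<eta>"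
  obtains ss where "plegma L k ss n" and "l \<le> elem (ss 0) 0"
    and "norm (\<Sum>j<n. b j *\<^sub>R (x (ss j) - x0)) \<le> 2 * \<beta> + \<eta>"
proof -
  obtain c H where c: "b = (\<lambda>j. if j \<in> H then c j else 0)" "norm (\<Sum>j<n. c j *\<^sub>R e j) \<le> \<beta>"
    using block_source[OF b] by blast
  have "0 < n" using block_facts(5)[OF b] by simp
  then obtain ss where "plegma L k ss n" "l \<le> elem (ss 0) 0"
    "norm (\<Sum>j<n. b j *\<^sub>R (x (ss j) - x0)) \<le> 2 * norm (\<Sum>j<n. c j *\<^sub>R e j) + \<eta>"
    using restricted_averaging[OF L _ \<eta>, of n l H c] unfolding c(1) by blast
  then show ?thesis using c(2) that by force
qed

text \<open>As the supports do not overlap, \<open>b - b'\<close> is a restriction of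
  \<open>c - c'\<close> to an index set, and restricted averaging applies. Its coefficients sum to
  0, so \<open>x0\<close> cancels and the bound passes from the terms \<open>x (ss j)\<close> to the
  model.\<close>

lemma block_diff_successive:
  assumes b: "block \<beta> r n b" and b': "block \<beta>' n n' b'"
  shows "norm ((\<Sum>j<n. b j *\<^sub>R e j) - (\<Sum>j<n'. b' j *\<^sub>R e j)) \<le> 2 * (\<beta> + \<beta>')"
proof -
  obtain c H where c: "b = (\<lambda>j. if j \<in> H then c j else 0)"
      "\<And>j. n \<le> j \<Longrightarrow> c j = 0" "norm (\<Sum>j<n. c j *\<^sub>R e j) \<le> \<beta>"
    using block_source[OF b] by blast
  obtain c' H' where c': "b' = (\<lambda>j. if j \<in> H' then c' j else 0)"
      "\<And>j. j < n \<Longrightarrow> c' j = 0" "norm (\<Sum>j<n'. c' j *\<^sub>R e j) \<le> \<beta>'"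
    using block_source[OF b'] by blast
  have n: "n < n'" using block_facts(5)[OF b'] .
  define d where "d = (\<lambda>j. c j - c' j)"
  define D where "D = {j. if j < n then j \<in> H else j \<in> H'}"
  define f where "f = (\<lambda>j. b j - b' j)"
  have f: "f = (\<lambda>j. if j \<in> D then d j else 0)"
    by (rule ext) (auto simp: f_def D_def d_def c(1) c'(1) c(2) c'(2) not_less)
  have ext: "(\<Sum>j<n'. b j *\<^sub>R g j) = (\<Sum>j<n. b j *\<^sub>R g j)"
      "(\<Sum>j<n'. c j *\<^sub>R g j) = (\<Sum>j<n. c j *\<^sub>R g j)" for g :: "nat \<Rightarrow> 'b"
    using sum_extend[of n b n' g] sum_extend[of n c n' g] block_facts(4)[OF b] c(2) n by auto
  have "(\<Sum>j<n'. b j) = (\<Sum>j<n. b j)"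
    using block_facts(4)[OF b] n by (intro sum.mono_neutral_right) auto
  then have f0: "(\<Sum>j<n'. f j) = 0"
    using block_facts(2)[OF b] block_facts(2)[OF b'] by (simp add: f_def sum_subtractf)
  have "norm (\<Sum>j<n'. d j *\<^sub>R e j) \<le> \<beta> + \<beta>'"
    using norm_triangle_ineq4[of "\<Sum>j<n. c j *\<^sub>R e j" "\<Sum>j<n'. c' j *\<^sub>R e j"] c(3) c'(3)
    by (simp add: d_def scaleR_diff_left sum_subtractf ext)
  moreover have "norm (\<Sum>j<n'. f j *\<^sub>R e j) \<le> 2 * norm (\<Sum>j<n'. d j *\<^sub>R e j)"
  proof (rule field_le_epsilon)
    fix \<eta> :: real assume \<eta>: "0 < \<eta>"
    obtain l where l: "\<And>ss. plegma M k ss n' \<Longrightarrow> l \<le> elem (ss 0) 0 \<Longrightarrow>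
        \<bar>norm (\<Sum>j<n'. f j *\<^sub>R x (ss j)) - norm (\<Sum>j<n'. f j *\<^sub>R e j)\<bar> \<le> \<eta> / 2"
      using plegma_limitE[OF limit, of n' "\<eta> / 2"] n \<eta> by auto
    obtain ss where ss: "plegma M k ss n'" "l \<le> elem (ss 0) 0"
      "norm (\<Sum>j<n'. f j *\<^sub>R (x (ss j) - x0)) \<le> 2 * norm (\<Sum>j<n'. d j *\<^sub>R e j) + \<eta> / 2"
      using restricted_averaging[OF M order_refl, of n' "\<eta> / 2" l D d] n \<eta> unfolding f by auto
    have "(\<Sum>j<n'. f j *\<^sub>R (x (ss j) - x0)) = (\<Sum>j<n'. f j *\<^sub>R x (ss j)) - (\<Sum>j<n'. f j) *\<^sub>R x0"
      by (simp add: scaleR_diff_right sum_subtractf scaleR_sum_left)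
    then have eq: "(\<Sum>j<n'. f j *\<^sub>R (x (ss j) - x0)) = (\<Sum>j<n'. f j *\<^sub>R x (ss j))"
      using f0 by simp
    show "norm (\<Sum>j<n'. f j *\<^sub>R e j) \<le> 2 * norm (\<Sum>j<n'. d j *\<^sub>R e j) + \<eta>"
      using ss(3) l[OF ss(1,2)] unfolding eq by linarith
  qed
  moreover have "(\<Sum>j<n. b j *\<^sub>R e j) - (\<Sum>j<n'. b' j *\<^sub>R e j) = (\<Sum>j<n'. f j *\<^sub>R e j)"
    by (simp add: f_def scaleR_diff_left sum_subtractf ext)
  ultimately show ?thesis by simp
qed

lemma norm_block:
  assumes b: "block \<beta> r n b"
  shows "\<bar>norm (\<Sum>j<n. b j *\<^sub>R e j) - norm x0\<bar> \<le> 2 * \<beta>"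
proof (rule field_le_epsilon)
  fix \<eta> :: real assume \<eta>: "0 < \<eta>"
  obtain l where l: "\<And>ss. plegma M k ss n \<Longrightarrow> l \<le> elem (ss 0) 0 \<Longrightarrow>
      \<bar>norm (\<Sum>j<n. b j *\<^sub>R x (ss j)) - norm (\<Sum>j<n. b j *\<^sub>R e j)\<bar> \<le> \<eta> / 2"
    using plegma_limitE[OF limit, of n "\<eta> / 2"] block_facts(5)[OF b] \<eta> by auto
  obtain ss where ss: "plegma M k ss n" "l \<le> elem (ss 0) 0"
    "norm (\<Sum>j<n. b j *\<^sub>R (x (ss j) - x0)) \<le> 2 * \<beta> + \<eta> / 2"
    using block_averaging[OF b M order_refl, of "\<eta> / 2" l] \<eta> by auto
  have "(\<Sum>j<n. b j *\<^sub>R (x (ss j) - x0)) = (\<Sum>j<n. b j *\<^sub>R x (ss j)) - (\<Sum>j<n. b j) *\<^sub>R x0"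
    by (simp add: scaleR_diff_right sum_subtractf scaleR_sum_left)
  then have "\<bar>norm (\<Sum>j<n. b j *\<^sub>R x (ss j)) - norm x0\<bar> \<le> 2 * \<beta> + \<eta> / 2"
    using ss(3) norm_triangle_ineq3[of "\<Sum>j<n. b j *\<^sub>R x (ss j)" x0] block_facts(2)[OF b] by simp
  then show "\<bar>norm (\<Sum>j<n. b j *\<^sub>R e j) - norm x0\<bar> \<le> 2 * \<beta> + \<eta>"
    using l[OF ss(1,2)] by linarith
qed

lemma block_shift:
  assumes b: "block \<beta> r n b"
  shows "block \<beta> (q + r) (q + n) (concat_at q (\<lambda>_. 0) b)"
proof -
  obtain c H where c: "b = (\<lambda>j. if j \<in> H then c j else 0)" "\<And>j. j < r \<Longrightarrow> c j = 0"
      "\<And>j. n \<le> j \<Longrightarrow> c j = 0" "norm (\<Sum>j<n. c j *\<^sub>R e j) \<le> \<beta>"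
    using block_source[OF b] by blast
  have "(\<Sum>j<q + n. concat_at q (\<lambda>_. 0) b j) = 1"
    using sum_concat_at[where r = q and m = n and a = "\<lambda>_. 0" and b = b and f = "\<lambda>_. 1 :: real"]
      block_facts(2)[OF b] by simp
  moreover have "norm (\<Sum>j<q + n. concat_at q (\<lambda>_. 0) c j *\<^sub>R e j) \<le> \<beta>"
    using c(4) by (simp add: sum_concat_at norm_shift)
  ultimately show ?thesis
    using c(2,3) block_facts(1)[OF b] unfolding block_def
    by (intro exI[of _ "concat_at q (\<lambda>_. 0) c"] exI[of _ "{j. j - q \<in> H}"])
      (auto simp: concat_at_def c(1))
qed

lemma exists_block:
  assumes nl1: "\<not> l1_equiv e" and \<beta>: "0 < \<beta>"
  obtains n b where "block \<beta> r n b"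
proof -
  \<comment> \<open>The bound \<open>norm x0 / 2\<close> forces the coefficient sum below half the
    mass, so the positive part \<sigma> carries at least a quarter of it. Normalising by \<sigma>
    then costs a factor 4, absorbed by \<open>\<beta> / 4\<close>.\<close>
  define c where "c = min (norm x0 / 2) (\<beta> / 4)"
  have c: "0 < c" "c \<le> norm x0 / 2" "4 * c \<le> \<beta>" using x0 \<beta> by (auto simp: c_def)
  \<comment> \<open>The upper \<ell>1 estimate always holds by \<open>norm_le_l1\<close>, so it is
    the lower one that fails.\<close>
  obtain m a where a: "norm (\<Sum>j<m. a j *\<^sub>R e j) < c * (\<Sum>j<m. \<bar>a j\<bar>)"
    using nl1 c(1) norm_le_l1 unfolding l1_equiv_def not_le[symmetric] by metis
  define A where "A = (\<Sum>j<m. \<bar>a j\<bar>)"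
  have A: "0 < A"
    using a c(1) norm_ge_zero[of "\<Sum>j<m. a j *\<^sub>R e j"] unfolding A_def
    by (metis le_less_trans zero_less_mult_pos)
  define \<sigma> where "\<sigma> = (\<Sum>j<m. if 0 < a j then a j else 0)"
  have "2 * \<sigma> = (\<Sum>j<m. \<bar>a j\<bar> + a j)"
    unfolding \<sigma>_def sum_distrib_left by (intro sum.cong) auto
  then have "2 * \<sigma> = A + (\<Sum>j<m. a j)" by (simp add: A_def sum.distrib)
  moreover have "\<bar>\<Sum>j<m. a j\<bar> \<le> A / 2"
  proof -
    have "\<bar>\<Sum>j<m. a j\<bar> * norm x0 \<le> c * A"
      using sum_le_norm[of a m] a by (simp add: A_def)
    also have "\<dots> \<le> norm x0 / 2 * A" using c(2) A by (intro mult_right_mono) auto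
    finally have "\<bar>\<Sum>j<m. a j\<bar> * norm x0 \<le> (A / 2) * norm x0" by (simp add: mult.commute)
    then show ?thesis using x0 by (simp add: mult_le_cancel_right)
  qed
  ultimately have \<sigma>: "A \<le> 4 * \<sigma>" by linarith
  then have \<sigma>0: "0 < \<sigma>" using A by simp
  define d where "d = (\<lambda>j. if j < m then a j / \<sigma> else 0)"
  have "norm (\<Sum>j<m. d j *\<^sub>R e j) = norm (inverse \<sigma> *\<^sub>R (\<Sum>j<m. a j *\<^sub>R e j))"
    by (simp add: d_def scaleR_sum_right divide_inverse mult.commute)
  also have "\<dots> \<le> inverse \<sigma> * (c * A)" using a \<sigma>0 by (simp add: A_def)
  also have "\<dots> \<le> inverse \<sigma> * (c * (4 * \<sigma>))" using \<sigma> \<sigma>0 c(1) by simp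
  also have "\<dots> = 4 * c" using \<sigma>0 by (simp add: field_simps)
  also have "\<dots> \<le> \<beta>" by (rule c(3))
  finally have d: "norm (\<Sum>j<m. d j *\<^sub>R e j) \<le> \<beta>" .
  define b where "b = (\<lambda>j. if 0 < d j then d j else 0)"
  have "(\<Sum>j<m. b j) = (\<Sum>j<m. (if 0 < a j then a j else 0) / \<sigma>)"
    using \<sigma>0 by (intro sum.cong) (auto simp: b_def d_def zero_less_divide_iff)
  also have "\<dots> = 1" using \<sigma>0 by (simp add: \<sigma>_def flip: sum_divide_distrib)
  finally have "block \<beta> 0 m b"
    unfolding block_def using d
    by (intro exI[of _ d] exI[of _ "{j. 0 < d j}"]) (auto simp: b_def d_def)
  then show ?thesis using block_shift[of \<beta> 0 m b r] that by auto
qed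

text \<open>Two blocks with overlapping supports are both compared with a third one that begins
  after both of them.\<close>

lemma block_diff:
  assumes nl1: "\<not> l1_equiv e" and b: "block \<beta> r n b" and b': "block \<beta>' r' n' b'"
  shows "norm ((\<Sum>j<n. b j *\<^sub>R e j) - (\<Sum>j<n'. b' j *\<^sub>R e j)) \<le> 2 * (\<beta> + \<beta>')"
proof (rule field_le_epsilon)
  fix \<eta> :: real assume \<eta>: "0 < \<eta>"
  obtain N d where d: "block (\<eta> / 4) (max n n') N d"
    using exists_block[OF nl1, of "\<eta> / 4" "max n n'"] \<eta> by auto
  have "norm ((\<Sum>j<n. b j *\<^sub>R e j) - (\<Sum>j<N. d j *\<^sub>R e j)) \<le> 2 * (\<beta> + \<eta> / 4)"
    by (rule block_diff_successive[OF b block_start_mono[OF d]]) simp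
  moreover have "norm ((\<Sum>j<n'. b' j *\<^sub>R e j) - (\<Sum>j<N. d j *\<^sub>R e j)) \<le> 2 * (\<beta>' + \<eta> / 4)"
    by (rule block_diff_successive[OF b' block_start_mono[OF d]]) simp
  ultimately show "norm ((\<Sum>j<n. b j *\<^sub>R e j) - (\<Sum>j<n'. b' j *\<^sub>R e j)) \<le> 2 * (\<beta> + \<beta>') + \<eta>"
    using norm_triangle_ineq4[of "(\<Sum>j<n. b j *\<^sub>R e j) - (\<Sum>j<N. d j *\<^sub>R e j)"
        "(\<Sum>j<n'. b' j *\<^sub>R e j) - (\<Sum>j<N. d j *\<^sub>R e j)"] by simp
qed

text \<open>Asking for an estimate over all blocks, instead of the limit of one sequence, lets the
  same vector serve every block and all of its shifts. The bound is that of
  \<open>block_diff\<close> with the second parameter tending to 0.\<close>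

definition block_limit :: "'b \<Rightarrow> bool" where
  "block_limit v \<longleftrightarrow>
     (\<forall>\<beta> r n b. block \<beta> r n b \<longrightarrow> norm ((\<Sum>j<n. b j *\<^sub>R e j) - v) \<le> 2 * \<beta>)"

lemma block_limitD:
  "block_limit v \<Longrightarrow> block \<beta> r n b \<Longrightarrow> norm ((\<Sum>j<n. b j *\<^sub>R e j) - v) \<le> 2 * \<beta>"
  unfolding block_limit_def by blast

text \<open>Blocks with parameters tending to 0 are Cauchy by \<open>block_diff\<close>; the
  estimate for arbitrary blocks and the norm of the limit follow by letting the second block run
  through this sequence.\<close>

lemma exists_block_limit:
  assumes nl1: "\<not> l1_equiv e"
  obtains e1 where "e1 \<in> closure (span (range e))"
    and "block_limit e1" and "norm e1 = norm x0"
proof -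
  have "\<exists>n b. block (inverse (real (Suc i))) 0 n b" for i
    using exists_block[OF nl1, of "inverse (real (Suc i))" 0]
    by (metis inverse_positive_iff_positive of_nat_0_less_iff zero_less_Suc)
  then obtain n b where nb: "\<And>i. block (inverse (real (Suc i))) 0 (n i) (b i)" by metis
  define v where "v = (\<lambda>i. \<Sum>j<n i. b i j *\<^sub>R e j)"
  have inv: "(\<lambda>i. inverse (real (Suc i))) \<longlonglongrightarrow> 0" by (rule LIMSEQ_inverse_real_of_nat)
  have "Cauchy v"
    unfolding Cauchy_def dist_norm
  proof (intro allI impI)
    fix \<epsilon> :: real assume "0 < \<epsilon>"
    then obtain I where I: "\<And>i. i \<ge> I \<Longrightarrow> inverse (real (Suc i)) < \<epsilon> / 4"
      using LIMSEQ_D[OF inv, of "\<epsilon> / 4"] by auto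
    have "norm (v i - v i') < \<epsilon>" if "i \<ge> I" "i' \<ge> I" for i i'
      using block_diff[OF nl1 nb[of i] nb[of i']] I[OF that(1)] I[OF that(2)] by (simp add: v_def)
    then show "\<exists>I. \<forall>i\<ge>I. \<forall>i'\<ge>I. norm (v i - v i') < \<epsilon>" by blast
  qed
  then obtain e1 where e1: "v \<longlonglongrightarrow> e1" by (auto simp: Cauchy_convergent_iff convergent_def)
  have "v i \<in> span (range e)" for i
    unfolding v_def by (intro span_sum span_scale span_base) auto
  then have "e1 \<in> closure (span (range e))" using e1 closure_sequential by blast
  moreover have "block_limit e1"
    unfolding block_limit_def
  proof (intro allI impI)
    fix \<beta> r n b assume b: "block \<beta> r n b"
    have "(\<lambda>i. norm ((\<Sum>j<n. b j *\<^sub>R e j) - v i)) \<longlonglongrightarrow> norm ((\<Sum>j<n. b j *\<^sub>R e j) - e1)"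
      by (intro tendsto_intros e1)
    moreover have "(\<lambda>i. 2 * (\<beta> + inverse (real (Suc i)))) \<longlonglongrightarrow> 2 * (\<beta> + 0)"
      by (intro tendsto_intros inv)
    ultimately have "norm ((\<Sum>j<n. b j *\<^sub>R e j) - e1) \<le> 2 * (\<beta> + 0)"
      by (rule LIMSEQ_le) (use block_diff[OF nl1 b nb] in \<open>auto simp: v_def\<close>)
    then show "norm ((\<Sum>j<n. b j *\<^sub>R e j) - e1) \<le> 2 * \<beta>" by simp
  qed
  moreover have "norm e1 = norm x0"
  proof -
    have "(\<lambda>i. \<bar>norm (v i) - norm x0\<bar>) \<longlonglongrightarrow> \<bar>norm e1 - norm x0\<bar>"
      by (intro tendsto_intros e1)
    moreover have "(\<lambda>i. 2 * inverse (real (Suc i))) \<longlonglongrightarrow> 2 * 0"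
      by (intro tendsto_intros inv)
    ultimately have "\<bar>norm e1 - norm x0\<bar> \<le> 2 * 0"
      by (rule LIMSEQ_le) (use norm_block[OF nb] in \<open>auto simp: v_def\<close>)
    then show ?thesis by simp
  qed
  ultimately show ?thesis by (rule that)
qed

text \<open>The block limit is invariant under the shift, whereas no nonzero convergent expansion is.\<close>

lemma not_schauder_basic:
  assumes nl1: "\<not> l1_equiv e"
  shows "\<not> schauder_basic e"
proof
  assume sch: "schauder_basic e"
  obtain e1 where e1: "e1 \<in> closure (span (range e))"
    and lim: "block_limit e1" and norm_e1: "norm e1 = norm x0"
    using exists_block_limit[OF nl1] by blast
  obtain a where a: "(\<lambda>n. a n *\<^sub>R e n) sums e1"
    and uniq: "\<And>a'. (\<lambda>n. a' n *\<^sub>R e n) sums e1 \<Longrightarrow> a' = a"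
    using sch e1 unfolding schauder_basic_def by blast
  \<comment> \<open>The partial sum minus a block has the same norm after a shift, while the block
    and the shifted block both lie within \<open>\<eta> / 2\<close> of \<open>e1\<close>.\<close>
  have bound: "norm ((\<Sum>j<m. a j *\<^sub>R e (Suc j)) - e1) \<le> norm ((\<Sum>j<m. a j *\<^sub>R e j) - e1)" for m
  proof (rule field_le_epsilon)
    fix \<eta> :: real assume "0 < \<eta>"
    then obtain n b where b: "block (\<eta> / 4) m n b"
      using exists_block[OF nl1, of "\<eta> / 4" m] by auto
    have n: "m \<le> n" using block_facts(5)[OF b] by simp
    have bs: "norm ((\<Sum>j<n. b j *\<^sub>R e (Suc j)) - e1) \<le> 2 * (\<eta> / 4)"
      using block_limitD[OF lim block_shift[OF b, of 1]]
        sum_concat_at[where r = 1 and m = n and a = "\<lambda>_. 0" and b = b and f = e] by simp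
    define d where "d = (\<lambda>j. trunc m a j - b j)"
    have d: "(\<Sum>j<n. d j *\<^sub>R f j) = (\<Sum>j<m. a j *\<^sub>R f j) - (\<Sum>j<n. b j *\<^sub>R f j)" for f :: "nat \<Rightarrow> 'b"
    proof -
      have "(\<Sum>j<n. trunc m a j *\<^sub>R f j) = (\<Sum>j<m. trunc m a j *\<^sub>R f j)"
        using n by (intro sum_extend) (auto simp: trunc_def)
      also have "\<dots> = (\<Sum>j<m. a j *\<^sub>R f j)" by (simp add: trunc_def)
      finally show ?thesis by (simp add: d_def scaleR_diff_left sum_subtractf)
    qed
    have "norm ((\<Sum>j<m. a j *\<^sub>R e (Suc j)) - (\<Sum>j<n. b j *\<^sub>R e (Suc j))) =
        norm ((\<Sum>j<m. a j *\<^sub>R e j) - (\<Sum>j<n. b j *\<^sub>R e j))"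
      using norm_shift[of d 1 n] by (simp add: d)
    then show "norm ((\<Sum>j<m. a j *\<^sub>R e (Suc j)) - e1) \<le> norm ((\<Sum>j<m. a j *\<^sub>R e j) - e1) + \<eta>"
      using bs block_limitD[OF lim b]
        norm_triangle_ineq[of "(\<Sum>j<m. a j *\<^sub>R e (Suc j)) - (\<Sum>j<n. b j *\<^sub>R e (Suc j))"
          "(\<Sum>j<n. b j *\<^sub>R e (Suc j)) - e1"]
        norm_triangle_ineq4[of "(\<Sum>j<m. a j *\<^sub>R e j) - e1" "(\<Sum>j<n. b j *\<^sub>R e j) - e1"]
      by simp
  qed
  have "(\<lambda>m. norm ((\<Sum>j<m. a j *\<^sub>R e j) - e1)) \<longlonglongrightarrow> 0"
    using a unfolding sums_def by (simp add: LIM_zero tendsto_norm_zero)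
  then have "(\<lambda>m. (\<Sum>j<m. a j *\<^sub>R e (Suc j)) - e1) \<longlonglongrightarrow> 0"
    by (rule Lim_null_comparison[OF always_eventually[OF allI[OF bound]]])
  then have "(\<lambda>n. a n *\<^sub>R e (Suc n)) sums e1"
    unfolding sums_def by (rule LIM_zero_cancel)
  then have "(\<lambda>n. concat_at 1 (\<lambda>_. 0) a n *\<^sub>R e n) sums e1"
    using sums_Suc_imp[of "\<lambda>n. concat_at 1 (\<lambda>_. 0) a n *\<^sub>R e n" e1] by (simp add: concat_at_def)
  \<comment> \<open>Uniqueness identifies the expansion with its shift, so \<open>a 0 = 0\<close>
    and each coefficient equals its predecessor.\<close>
  then have shift: "concat_at 1 (\<lambda>_. 0) a = a" by (rule uniq)
  have "a n = 0" for n
  proof (induction n)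
    case 0
    show ?case using fun_cong[OF shift, of 0] by (simp add: concat_at_def)
  next
    case (Suc n)
    then show ?case using fun_cong[OF shift, of "Suc n"] by (simp add: concat_at_def)
  qed
  then have "(\<lambda>n. a n *\<^sub>R e n) sums 0" by simp
  then have "e1 = 0" by (rule sums_unique2[OF a])
  then show False using norm_e1 x0 by simp
qed

text \<open>A block starting at a large \<open>r\<close> is a convex combination of terms on which
  \<open>f\<close> is close to \<open>f e0\<close>, while the block itself is close to
  \<open>e1\<close> in norm.\<close>

lemma weak_limit_eq_block_limit:
  assumes nl1: "\<not> l1_equiv e" and e0: "weakly_converges e e0"
    and lim: "block_limit e1"
  shows "e0 = e1"
proof (rule functionals_separate_points)
  fix f :: "'b \<Rightarrow> real" assume f: "bounded_linear f"
  then have lin: "linear f" by (rule bounded_linear.linear)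
  obtain K where K: "0 \<le> K" "\<And>y. norm (f y) \<le> norm y * K"
    using bounded_linear.nonneg_bounded[OF f] by blast
  show "f e0 = f e1"
  proof (rule eq_if_abs_diff_le_mult[where K = "1 + 2 * K"])
    fix \<eta> :: real assume \<eta>: "0 < \<eta>"
    have "(\<lambda>j. f (e j)) \<longlonglongrightarrow> f e0" using e0 f by (simp add: weakly_converges_def)
    then obtain r where r: "\<And>j. r \<le> j \<Longrightarrow> \<bar>f (e j) - f e0\<bar> < \<eta>"
      using LIMSEQ_D[OF _ \<eta>] by (metis real_norm_def)
    obtain n b where b: "block \<eta> r n b" using exists_block[OF nl1 \<eta>] by blast
    have "f (\<Sum>j<n. b j *\<^sub>R e j) - f e0 = (\<Sum>j<n. b j * f (e j)) - (\<Sum>j<n. b j) * f e0"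
      using block_facts(2)[OF b] by (simp add: linear_sum[OF lin] linear_scale[OF lin])
    also have "\<dots> = (\<Sum>j<n. b j * (f (e j) - f e0))"
      by (simp add: sum_distrib_right right_diff_distrib sum_subtractf)
    also have "\<bar>\<dots>\<bar> \<le> (\<Sum>j<n. b j * \<eta>)"
    proof (rule order_trans[OF sum_abs], rule sum_mono)
      fix j
      show "\<bar>b j * (f (e j) - f e0)\<bar> \<le> b j * \<eta>"
        using block_facts(1,3)[OF b, of j] r[of j]
        by (cases "j < r") (auto simp: abs_mult intro!: mult_left_mono)
    qed
    also have "\<dots> = \<eta>" using block_facts(2)[OF b] by (simp flip: sum_distrib_right)
    finally have 1: "\<bar>f (\<Sum>j<n. b j *\<^sub>R e j) - f e0\<bar> \<le> \<eta>" .
    have "\<bar>f (\<Sum>j<n. b j *\<^sub>R e j) - f e1\<bar> \<le> norm ((\<Sum>j<n. b j *\<^sub>R e j) - e1) * K"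
      using K(2)[of "(\<Sum>j<n. b j *\<^sub>R e j) - e1"] by (simp add: linear_diff[OF lin])
    also have "\<dots> \<le> 2 * \<eta> * K" using block_limitD[OF lim b] K(1) by (rule mult_right_mono)
    finally show "\<bar>f e0 - f e1\<bar> \<le> (1 + 2 * K) * \<eta>" using 1 by (simp add: algebra_simps)
  qed
qed

text \<open>Subtracting \<sigma> times a block makes the coefficient sum 0, so \<open>x0\<close>
  cancels and the model \<open>e\<close> computes the norm. The correction is negligible for the
  differences \<open>x (ss j) - x0\<close>, whereas on the model side the block approximates
  \<open>e1\<close> and turns \<open>e j\<close> into \<open>e j - e1\<close>.\<close>

lemma ksm_of_differences_isometric:
  assumes nl1: "\<not> l1_equiv e"
    and lim: "block_limit e1"
    and L: "infinite L" "L \<subseteq> M" and p: "generates_ksm_sn k (\<lambda>s. x s - x0) L p"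
  shows "isometric_equiv_sn p (\<lambda>n. e n - e1)"
  unfolding isometric_equiv_sn_def
proof (intro allI)
  fix m :: nat and a :: "nat \<Rightarrow> real"
  show "p (trunc m a) = norm (\<Sum>j<m. a j *\<^sub>R (e j - e1))"
  proof (cases "m = 0")
    case True
    then show ?thesis using p by (simp add: generates_ksm_sn_def seminorm_trunc_0)
  next
    case False
    then have m: "0 < m" by simp
    define \<sigma> where "\<sigma> = (\<Sum>j<m. a j)"
    show ?thesis
    \<comment> \<open>The two spreading model limits cost \<eta> each, the averaged block costs
      \<open>3 * \<bar>\<sigma>\<bar> * \<eta>\<close>, and its distance to \<open>e1\<close> costs
      \<open>2 * \<bar>\<sigma>\<bar> * \<eta>\<close>.\<close>
    proof (rule eq_if_abs_diff_le_mult[where K = "2 + 5 * \<bar>\<sigma>\<bar>"])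
      fix \<eta> :: real assume \<eta>: "0 < \<eta>"
      obtain n b where b: "block \<eta> m n b" using exists_block[OF nl1 \<eta>] by blast
      have n: "m \<le> n" "0 < n" using block_facts(5)[OF b] by auto
      define d where "d = (\<lambda>j. trunc m a j - \<sigma> * b j)"
      have d: "(\<Sum>j<n. d j *\<^sub>R f j) = (\<Sum>j<m. a j *\<^sub>R f j) - \<sigma> *\<^sub>R (\<Sum>j<n. b j *\<^sub>R f j)"
        for f :: "nat \<Rightarrow> 'c::real_vector"
      proof -
        have "(\<Sum>j<n. trunc m a j *\<^sub>R f j) = (\<Sum>j<m. trunc m a j *\<^sub>R f j)"
          using n by (intro sum_extend) (auto simp: trunc_def)
        also have "\<dots> = (\<Sum>j<m. a j *\<^sub>R f j)" by (simp add: trunc_def)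
        finally show ?thesis by (simp add: d_def scaleR_diff_left sum_subtractf scaleR_sum_right)
      qed
      obtain l1 where l1: "\<And>ss. plegma L k ss n \<Longrightarrow> l1 \<le> elem (ss 0) 0 \<Longrightarrow>
          \<bar>norm (\<Sum>j<n. d j *\<^sub>R x (ss j)) - norm (\<Sum>j<n. d j *\<^sub>R e j)\<bar> \<le> \<eta>"
        using plegma_limitE[OF plegma_limit_mono[OF limit L(2)] n(2) \<eta>] by blast
      obtain l2 where l2: "\<And>ss. plegma L k ss m \<Longrightarrow> l2 \<le> elem (ss 0) 0 \<Longrightarrow>
          \<bar>norm (\<Sum>j<m. a j *\<^sub>R (x (ss j) - x0)) - p (trunc m a)\<bar> \<le> \<eta>"
        using plegma_limitE[OF generates_ksm_sn_plegma_limit[OF p] m \<eta>] by blast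
      obtain ss where ss: "plegma L k ss n" "max l1 l2 \<le> elem (ss 0) 0"
        and small: "norm (\<Sum>j<n. b j *\<^sub>R (x (ss j) - x0)) \<le> 2 * \<eta> + \<eta>"
        using block_averaging[OF b L \<eta>] by blast
      have "plegma L k ss m" using plegma_interval(1)[OF ss(1) _ m k, of 0] n(1) by simp
      then have 1: "\<bar>norm (\<Sum>j<m. a j *\<^sub>R (x (ss j) - x0)) - p (trunc m a)\<bar> \<le> \<eta>"
        using l2 ss(2) by simp
      define S where "S = (\<Sum>j<n. b j *\<^sub>R (x (ss j) - x0))"
      have "(\<Sum>j<n. d j) = 0"
        using d[of "\<lambda>_. 1 :: real"] block_facts(2)[OF b] by (simp add: \<sigma>_def)
      then have "(\<Sum>j<n. d j *\<^sub>R (x (ss j) - x0)) = (\<Sum>j<n. d j *\<^sub>R x (ss j))"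
        by (simp add: scaleR_diff_right sum_subtractf flip: scaleR_sum_left)
      then have 2: "(\<Sum>j<m. a j *\<^sub>R (x (ss j) - x0)) - \<sigma> *\<^sub>R S = (\<Sum>j<n. d j *\<^sub>R x (ss j))"
        by (simp add: d S_def)
      have 3: "norm (\<sigma> *\<^sub>R S) \<le> 3 * \<bar>\<sigma>\<bar> * \<eta>"
        using mult_left_mono[OF small, of "\<bar>\<sigma>\<bar>"] by (simp add: S_def)
      have 4: "\<bar>norm (\<Sum>j<n. d j *\<^sub>R x (ss j)) - norm (\<Sum>j<n. d j *\<^sub>R e j)\<bar> \<le> \<eta>"
        using l1 ss by simp
      define v where "v = (\<Sum>j<n. b j *\<^sub>R e j)"
      have 5: "(\<Sum>j<m. a j *\<^sub>R (e j - e1)) = (\<Sum>j<n. d j *\<^sub>R e j) + \<sigma> *\<^sub>R (v - e1)"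
        by (simp add: d v_def \<sigma>_def scaleR_diff_right sum_subtractf scaleR_sum_left)
      have 6: "norm (\<sigma> *\<^sub>R (v - e1)) \<le> 2 * \<bar>\<sigma>\<bar> * \<eta>"
        using mult_left_mono[OF block_limitD[OF lim b], of "\<bar>\<sigma>\<bar>"] by (simp add: v_def)
      have 7: "\<bar>norm (\<Sum>j<m. a j *\<^sub>R (e j - e1)) - norm (\<Sum>j<n. d j *\<^sub>R e j)\<bar> \<le> 2 * \<bar>\<sigma>\<bar> * \<eta>"
        using 5 6 norm_triangle_ineq3[of "\<Sum>j<m. a j *\<^sub>R (e j - e1)" "\<Sum>j<n. d j *\<^sub>R e j"] by simp
      have 8: "\<bar>norm (\<Sum>j<m. a j *\<^sub>R (x (ss j) - x0)) - norm (\<Sum>j<n. d j *\<^sub>R x (ss j))\<bar> \<le> 3 * \<bar>\<sigma>\<bar> * \<eta>"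
        using 3 norm_triangle_ineq3[of "\<Sum>j<m. a j *\<^sub>R (x (ss j) - x0)" "\<Sum>j<n. d j *\<^sub>R x (ss j)"]
        by (simp flip: 2)
      have "\<bar>p (trunc m a) - norm (\<Sum>j<m. a j *\<^sub>R (e j - e1))\<bar> \<le>
          \<eta> + 3 * \<bar>\<sigma>\<bar> * \<eta> + \<eta> + 2 * \<bar>\<sigma>\<bar> * \<eta>"
        by (rule abs_diff_chain[OF 1 8 4 7])
      then show "\<bar>p (trunc m a) - norm (\<Sum>j<m. a j *\<^sub>R (e j - e1))\<bar> \<le> (2 + 5 * \<bar>\<sigma>\<bar>) * \<eta>"
        by (simp add: algebra_simps)
    qed
  qed
qed

text \<open>The lower estimate comes from \<open>a\<close> followed by \<open>- a\<close> on a
  family of \<open>2 * m\<close> sets, the upper one from the triangle inequality and the bound of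
  the coefficient sum by the \<ell>1 norm.\<close>

lemma ksm_of_differences_l1:
  assumes l1: "l1_equiv e"
    and L: "infinite L" "L \<subseteq> M" and p: "generates_ksm_sn k (\<lambda>s. x s - x0) L p"
  shows "l1_equiv_sn p"
proof -
  obtain c where c: "0 < c" "\<And>m a. c * (\<Sum>j<m. \<bar>a j\<bar>) \<le> norm (\<Sum>j<m. a j *\<^sub>R e j)"
    using l1 unfolding l1_equiv_def by blast
  note limp = generates_ksm_sn_plegma_limit[OF p]
  note limL = plegma_limit_mono[OF limit L(2)]
  have "c * (\<Sum>j<m. \<bar>a j\<bar>) \<le> p (trunc m a) \<and> p (trunc m a) \<le> (norm (e 0) + norm x0) * (\<Sum>j<m. \<bar>a j\<bar>)"
    for m a
  proof (cases "m = 0")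
    case True
    then show ?thesis using p by (simp add: generates_ksm_sn_def seminorm_trunc_0)
  next
    case False
    then have m: "0 < m" by simp
    define A where "A = (\<Sum>j<m. \<bar>a j\<bar>)"
    define a' where "a' = concat_at m a (\<lambda>j. - a j)"
    have a': "(\<Sum>j<m + m. a' j *\<^sub>R f j) = (\<Sum>j<m. a j *\<^sub>R f j) - (\<Sum>j<m. a j *\<^sub>R f (m + j))"
      for f :: "nat \<Rightarrow> 'c::real_vector"
      by (simp add: a'_def sum_concat_at sum_negf)
    have "\<bar>a' j\<bar> = concat_at m (\<lambda>j. \<bar>a j\<bar>) (\<lambda>j. \<bar>a j\<bar>) j" for j
      by (simp add: a'_def concat_at_def)
    then have "(\<Sum>j<m + m. \<bar>a' j\<bar>) = 2 * A"
      using sum_concat_at[where r = m and m = m and a = "\<lambda>j. \<bar>a j\<bar>" and b = "\<lambda>j. \<bar>a j\<bar>"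
          and f = "\<lambda>_. 1 :: real"] by (simp add: A_def)
    then have low: "2 * c * A \<le> norm (\<Sum>j<m + m. a' j *\<^sub>R e j)" using c(2)[of a' "m + m"] by simp
    have *: "c * A \<le> p (trunc m a) + 2 * \<eta> \<and> p (trunc m a) \<le> (norm (e 0) + norm x0) * A + 2 * \<eta>"
      if \<eta>: "0 < \<eta>" for \<eta>
    proof -
      obtain l1 where l1: "\<And>ss. plegma L k ss (m + m) \<Longrightarrow> l1 \<le> elem (ss 0) 0 \<Longrightarrow>
          \<bar>norm (\<Sum>j<m + m. a' j *\<^sub>R x (ss j)) - norm (\<Sum>j<m + m. a' j *\<^sub>R e j)\<bar> \<le> \<eta>"
        using plegma_limitE[OF limL, of "m + m" \<eta>] m \<eta> by auto
      obtain l2 where l2: "\<And>ss. plegma L k ss m \<Longrightarrow> l2 \<le> elem (ss 0) 0 \<Longrightarrow>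
          \<bar>norm (\<Sum>j<m. a j *\<^sub>R (x (ss j) - x0)) - p (trunc m a)\<bar> \<le> \<eta>"
        using plegma_limitE[OF limp m \<eta>] by blast
      obtain l3 where l3: "\<And>ss. plegma L k ss m \<Longrightarrow> l3 \<le> elem (ss 0) 0 \<Longrightarrow>
          \<bar>norm (\<Sum>j<m. a j *\<^sub>R x (ss j)) - norm (\<Sum>j<m. a j *\<^sub>R e j)\<bar> \<le> \<eta>"
        using plegma_limitE[OF limL m \<eta>] by blast
      obtain ss where ss: "plegma L k ss (m + m)" "max l1 (max l2 l3) \<le> elem (ss 0) 0"
        using far_plegma[OF L, of "m + m" "max l1 (max l2 l3)"] m by (metis add_gr_0)
      define u where "u = (\<lambda>r. \<Sum>j<m. a j *\<^sub>R (x (ss (r + j)) - x0))"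
      have u: "\<bar>norm (u r) - p (trunc m a)\<bar> \<le> \<eta>" if "r \<le> m" for r
      proof -
        have "plegma L k (\<lambda>j. ss (r + j)) m" "elem (ss 0) 0 \<le> elem (ss r) 0"
          using plegma_interval[OF ss(1) _ m k, of r] that by auto
        then show ?thesis using l2[of "\<lambda>j. ss (r + j)"] ss(2) by (simp add: u_def)
      qed
      \<comment> \<open>The halves carry opposite coefficients, so \<open>x0\<close> cancels. Each
        half is a far plegma family, so both norms are close to \<open>p (trunc m a)\<close> and
        share the \<ell>1 mass \<open>2 * A\<close>.\<close>
      have "u 0 - u m = (\<Sum>j<m + m. a' j *\<^sub>R x (ss j))"
        by (simp add: u_def a' scaleR_diff_right sum_subtractf)
      then have "2 * c * A \<le> norm (u 0) + norm (u m) + \<eta>"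
        using low l1[OF ss(1)] ss(2) norm_triangle_ineq4[of "u 0" "u m"] by simp
      then have "c * A \<le> p (trunc m a) + 2 * \<eta>"
        using u[of 0] u[of m] \<eta> by simp
      moreover have "p (trunc m a) \<le> (norm (e 0) + norm x0) * A + 2 * \<eta>"
      proof -
        have pl: "plegma L k ss m" using plegma_interval(1)[OF ss(1) _ m k, of 0] by simp
        have "u 0 = (\<Sum>j<m. a j *\<^sub>R x (ss j)) - (\<Sum>j<m. a j) *\<^sub>R x0"
          by (simp add: u_def scaleR_diff_right sum_subtractf scaleR_sum_left)
        then have "norm (u 0) \<le> norm (\<Sum>j<m. a j *\<^sub>R x (ss j)) + \<bar>\<Sum>j<m. a j\<bar> * norm x0"
          using norm_triangle_ineq4[of "\<Sum>j<m. a j *\<^sub>R x (ss j)" "(\<Sum>j<m. a j) *\<^sub>R x0"] by simp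
        moreover have "\<bar>\<Sum>j<m. a j\<bar> * norm x0 \<le> A * norm x0"
          unfolding A_def by (intro mult_right_mono sum_abs) auto
        moreover have "norm (\<Sum>j<m. a j *\<^sub>R x (ss j)) \<le> norm (e 0) * A + \<eta>"
          using l3[OF pl] ss(2) norm_le_l1[of a m] by (simp add: A_def)
        ultimately show ?thesis using u[of 0] by (simp add: algebra_simps)
      qed
      ultimately show ?thesis ..
    qed
    have eps: "c * A \<le> p (trunc m a) + \<epsilon>" "p (trunc m a) \<le> (norm (e 0) + norm x0) * A + \<epsilon>"
      if "0 < \<epsilon>" for \<epsilon>
      using *[of "\<epsilon> / 2"] that by auto
    show ?thesis
      using field_le_epsilon[OF eps(1)] field_le_epsilon[OF eps(2)] by (simp add: A_def)
  qed
  then show ?thesis unfolding l1_equiv_sn_def using c(1) by blast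
qed

end

theorem mainTheorem7:
  fixes k :: nat
    and x :: "nat set \<Rightarrow> 'a::banach"
    and x0 :: 'a
    and M :: "nat set"
    and e :: "nat \<Rightarrow> 'b::banach"
  assumes "1 \<le> k"
    and "subordinated_weak k x x0"
    and "infinite M"
    and "generates_ksm k x M e"
    and "nontrivial_seq e"
    and "x0 \<noteq> 0"
  shows "(l1_equiv e \<and> (\<forall>p. is_ksm_of k (\<lambda>s. x s - x0) M p \<longrightarrow> l1_equiv_sn p))
     \<noteq> (singular_seq e \<and>
          (\<forall>e0. natural_decomposition e e0 \<longrightarrow>
             (\<forall>p. is_ksm_of k (\<lambda>s. x s - x0) M p \<longrightarrow> isometric_equiv_sn p (\<lambda>n. e n - e0))
             \<and> norm e0 = norm x0))"
proof -
  interpret weak_ksm k x x0 M e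
    using assms(1-3) generates_ksm_plegma_limit[OF assms(4)] assms(6) by (rule weak_ksm.intro)
  show ?thesis
  \<comment> \<open>The alternatives are decided by equivalence to the \<ell>1 basis: it makes
    \<open>e\<close> Schauder basic and so excludes (ii), while its failure excludes (i).\<close>
  proof (cases "l1_equiv e")
    case True
    then have "\<not> singular_seq e"
      using l1_equiv_imp_schauder_basic by (auto simp: singular_seq_def)
    moreover have "\<forall>p. is_ksm_of k (\<lambda>s. x s - x0) M p \<longrightarrow> l1_equiv_sn p"
      using ksm_of_differences_l1[OF True] by (auto simp: is_ksm_of_def)
    ultimately show ?thesis using True by blast
  next
    case False
    obtain e1 where "e1 \<in> closure (span (range e))"
      and lim: "block_limit e1" and e1: "norm e1 = norm x0"
      using exists_block_limit[OF False] by blast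
    have "singular_seq e"
      using not_schauder_basic[OF False] assms(5) by (simp add: singular_seq_def)
    \<comment> \<open>The vector of any natural decomposition is a weak limit of \<open>e\<close>,
      hence the block limit, so (ii) can be proved for \<open>e1\<close> alone.\<close>
    moreover have "e0 = e1" if "natural_decomposition e e0" for e0
      using that weak_limit_eq_block_limit[OF False _ lim] by (simp add: natural_decomposition_def)
    moreover have "isometric_equiv_sn p (\<lambda>n. e n - e1)" if "is_ksm_of k (\<lambda>s. x s - x0) M p" for p
      using that ksm_of_differences_isometric[OF False lim] by (auto simp: is_ksm_of_def)
    ultimately show ?thesis using False e1 by blast
  qed
qed

end
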